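(* Let $q$ be a prime power, let $D\ge 2$ be an integer, and let $x$ be a vertex of the bipartite dual polar graph $D_D(q)$. Let $Q=Q(x)$ be the quantum adjacency algebra and $T=T(x)$ the subconstituent algebra of $D_D(q)$ with respect to $x$. Then $Q\neq T$.
   Context: The bipartite dual polar graph $D_D(q)$: let $\mathcal{U}$ be a vector space of dimension $2D$ over the finite field $\mathbb{F}_q$ equipped with a nondegenerate quadratic form of Witt index $D$ (hyperbolic type). The vertices are the maximal totally singular subspaces of $\mathcal{U}$ (all of dimension $D$); two vertices are adjacent whenever their intersection has dimension $D-1$. For a finite, undirected, connected graph (no loops or multiple edges) with vertex set $X$, $\mathrm{Mat}_X(\mathbb{C})$ is the $\mathbb{C}$-algebra of matrices with rows and columns indexed by $X$. Subalgebras contain the identity $I$. Let $\partial$ be the path-length distance, $A\in\mathrm{Mat}_X(\mathbb{C})$ the adjacency matrix, $x\in X$ a fixed vertex, and $e=\max\{\partial(x,y): y\in X\}$. For $0\le i\le e$, $E_i^*$ is the diagonal matrix with $(y,y)$-entry $1$ if $\partial(x,y)=i$ and $0$ otherwise. The subconstituent algebra $T=T(x)$ is the subalgebra of $\mathrm{Mat}_X(\mathbb{C})$ generated by $A$ and $E_0^*,\dots,E_e^*$. Put $L=\sum_{i=1}^{e}E_{i-1}^*AE_i^*$, $F=\sum_{i=0}^{e}E_i^*AE_i^*$, $R=\sum_{i=0}^{e-1}E_{i+1}^*AE_i^*$. The quantum adjacency algebra $Q=Q(x)$ is the subalgebra of $T$ generated by $L,F,R$. *)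

theory Defs
  imports Complex_Main "HOL-Number_Theory.Prime_Powers"
begin

text \<open>The vector space is the whole type \<open>'v\<close>, with an explicit scalar multiplication
  \<open>scale\<close>; subspaces and dimension are those of the locale
  \<^locale>\<open>vector_space\<close>. The characteristic may be 2.\<close>

definition polar_form :: "('v::ab_group_add \<Rightarrow> 'k::ab_group_add) \<Rightarrow> 'v \<Rightarrow> 'v \<Rightarrow> 'k" where
  "polar_form f u v = f (u + v) - f u - f v"

definition quadratic_form ::
    "('k::field \<Rightarrow> 'v::ab_group_add \<Rightarrow> 'v) \<Rightarrow> ('v \<Rightarrow> 'k) \<Rightarrow> bool" where
  "quadratic_form scale f \<longleftrightarrow>
     (\<forall>a v. f (scale a v) = a\<^sup>2 * f v) \<and>
     (\<forall>u. Vector_Spaces.linear scale (*) (\<lambda>v. polar_form f u v)) \<and>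
     (\<forall>v. Vector_Spaces.linear scale (*) (\<lambda>u. polar_form f u v))"

text \<open>No nonzero singular vector lies in the radical of the polar form. In odd
  characteristic this says that the polar form is nondegenerate; in characteristic 2 it is the
  usual notion of a nondegenerate (nonsingular) quadratic form.\<close>

definition nondegenerate :: "('v::ab_group_add \<Rightarrow> 'k::ab_group_add) \<Rightarrow> bool" where
  "nondegenerate f \<longleftrightarrow> (\<forall>v. f v = 0 \<and> (\<forall>u. polar_form f u v = 0) \<longrightarrow> v = 0)"

definition totally_singular ::
    "('k::field \<Rightarrow> 'v::ab_group_add \<Rightarrow> 'v) \<Rightarrow> ('v \<Rightarrow> 'k) \<Rightarrow> 'v set \<Rightarrow> bool" where
  "totally_singular scale f W \<longleftrightarrow> module.subspace scale W \<and> (\<forall>w\<in>W. f w = 0)"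

definition witt_index ::
    "('k::field \<Rightarrow> 'v::ab_group_add \<Rightarrow> 'v) \<Rightarrow> ('v \<Rightarrow> 'k) \<Rightarrow> nat" where
  "witt_index scale f = Max (vector_space.dim scale ` {W. totally_singular scale f W})"

definition dual_polar_vertices ::
    "('k::field \<Rightarrow> 'v::ab_group_add \<Rightarrow> 'v) \<Rightarrow> ('v \<Rightarrow> 'k) \<Rightarrow> 'v set set" where
  "dual_polar_vertices scale f =
     {W. totally_singular scale f W \<and>
         (\<forall>W'. totally_singular scale f W' \<and> W \<subseteq> W' \<longrightarrow> W' = W)}"

definition dual_polar_edges ::
    "('k::field \<Rightarrow> 'v::ab_group_add \<Rightarrow> 'v) \<Rightarrow> ('v \<Rightarrow> 'k) \<Rightarrow> nat \<Rightarrow> 'v set rel" where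
  "dual_polar_edges scale f D =
     {(y, z). y \<in> dual_polar_vertices scale f \<and> z \<in> dual_polar_vertices scale f \<and>
              vector_space.dim scale (y \<inter> z) = D - 1}"

text \<open>\<open>Mat X\<close> is the algebra of complex matrices with rows and columns indexed by \<open>X\<close>; such a
  matrix is represented by a function that vanishes outside \<open>X \<times> X\<close>.\<close>

type_synonym 'x cmatrix = "'x \<Rightarrow> 'x \<Rightarrow> complex"

definition Mat :: "'x set \<Rightarrow> 'x cmatrix set" where
  "Mat X = {M. \<forall>y z. y \<notin> X \<or> z \<notin> X \<longrightarrow> M y z = 0}"

definition mat_one :: "'x set \<Rightarrow> 'x cmatrix" where
  "mat_one X = (\<lambda>y z. if y \<in> X \<and> y = z then 1 else 0)"

definition mat_add :: "'x cmatrix \<Rightarrow> 'x cmatrix \<Rightarrow> 'x cmatrix" where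
  "mat_add M N = (\<lambda>y z. M y z + N y z)"

definition mat_smult :: "complex \<Rightarrow> 'x cmatrix \<Rightarrow> 'x cmatrix" where
  "mat_smult c M = (\<lambda>y z. c * M y z)"

definition mat_mult :: "'x set \<Rightarrow> 'x cmatrix \<Rightarrow> 'x cmatrix \<Rightarrow> 'x cmatrix" where
  "mat_mult X M N = (\<lambda>y z. \<Sum>w\<in>X. M y w * N w z)"

definition mat_subalgebra :: "'x set \<Rightarrow> 'x cmatrix set \<Rightarrow> bool" where
  "mat_subalgebra X S \<longleftrightarrow>
     S \<subseteq> Mat X \<and> mat_one X \<in> S \<and>
     (\<forall>M\<in>S. \<forall>N\<in>S. mat_add M N \<in> S) \<and>
     (\<forall>c. \<forall>M\<in>S. mat_smult c M \<in> S) \<and>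
     (\<forall>M\<in>S. \<forall>N\<in>S. mat_mult X M N \<in> S)"

text \<open>The intersection of all subalgebras containing \<open>G\<close>; meaningful for \<open>G \<subseteq> Mat X\<close>.\<close>

definition generated_subalgebra :: "'x set \<Rightarrow> 'x cmatrix set \<Rightarrow> 'x cmatrix set" where
  "generated_subalgebra X G = mat_subalgebra X hull G"

text \<open>A finite simple graph is given by its vertex set \<open>X\<close> and its symmetric irreflexive
  adjacency relation \<open>E \<subseteq> X \<times> X\<close>. The distance is only meaningful for connected vertices.\<close>

definition path_dist :: "'x rel \<Rightarrow> 'x \<Rightarrow> 'x \<Rightarrow> nat" where
  "path_dist E y z = (LEAST n. (y, z) \<in> E ^^ n)"

definition eccentricity :: "'x set \<Rightarrow> 'x rel \<Rightarrow> 'x \<Rightarrow> nat" where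
  "eccentricity X E x = Max (path_dist E x ` X)"

definition adjacency_matrix :: "'x rel \<Rightarrow> 'x cmatrix" where
  "adjacency_matrix E = (\<lambda>y z. if (y, z) \<in> E then 1 else 0)"

definition dual_idempotent :: "'x set \<Rightarrow> 'x rel \<Rightarrow> 'x \<Rightarrow> nat \<Rightarrow> 'x cmatrix" where
  "dual_idempotent X E x i =
     (\<lambda>y z. if y \<in> X \<and> y = z \<and> path_dist E x y = i then 1 else 0)"

definition subconstituent_algebra :: "'x set \<Rightarrow> 'x rel \<Rightarrow> 'x \<Rightarrow> 'x cmatrix set" where
  "subconstituent_algebra X E x = generated_subalgebra X
     (insert (adjacency_matrix E) (dual_idempotent X E x ` {0..eccentricity X E x}))"

definition adjacency_block :: "'x set \<Rightarrow> 'x rel \<Rightarrow> 'x \<Rightarrow> nat \<Rightarrow> nat \<Rightarrow> 'x cmatrix" where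
  "adjacency_block X E x i j =
     mat_mult X (mat_mult X (dual_idempotent X E x i) (adjacency_matrix E))
       (dual_idempotent X E x j)"

definition lowering_matrix :: "'x set \<Rightarrow> 'x rel \<Rightarrow> 'x \<Rightarrow> 'x cmatrix" where
  "lowering_matrix X E x =
     (\<lambda>y z. \<Sum>i = 1..eccentricity X E x. adjacency_block X E x (i - 1) i y z)"

definition flat_matrix :: "'x set \<Rightarrow> 'x rel \<Rightarrow> 'x \<Rightarrow> 'x cmatrix" where
  "flat_matrix X E x =
     (\<lambda>y z. \<Sum>i = 0..eccentricity X E x. adjacency_block X E x i i y z)"

definition raising_matrix :: "'x set \<Rightarrow> 'x rel \<Rightarrow> 'x \<Rightarrow> 'x cmatrix" where
  "raising_matrix X E x =
     (\<lambda>y z. \<Sum>i = 0..<eccentricity X E x. adjacency_block X E x (i + 1) i y z)"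

definition quantum_adjacency_algebra :: "'x set \<Rightarrow> 'x rel \<Rightarrow> 'x \<Rightarrow> 'x cmatrix set" where
  "quantum_adjacency_algebra X E x = generated_subalgebra X
     {lowering_matrix X E x, flat_matrix X E x, raising_matrix X E x}"

end

theory Submission
  imports Defs
begin

text \<open>Write \<open>\<partial>\<close> for the distance and \<open>N k\<close> for the number of hyperplanes of a \<open>D\<close>-dimensional
  space that contain a given subspace of codimension \<open>k\<close>. The graph is bipartite, so \<open>F = 0\<close> and
  \<open>Q\<close> is generated by \<open>L\<close> and \<open>R\<close>. The idea is that \<open>L\<close> and \<open>R\<close> cannot tell in which
  subconstituent they act: there are two \<open>T\<close>-modules of the same shape, one starting in the
  first and one in the second subconstituent, that are isomorphic as \<open>Q\<close>-modules, whereas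
  \<open>E\<^sub>1\<^sup>*\<close> acts as the identity on the lowest vector of the one and as zero on that of the other.

  The modules are explicit. For a vertex \<open>y\<close> with \<open>\<partial>(x,y) = j\<close> consider, for each \<open>i\<close>, the indicator
  vector of the vertices \<open>u\<close> with \<open>\<partial>(y,u) = i\<close> and \<open>\<partial>(x,u) = j + i\<close>, and let \<open>e\<^sub>i\<close> be the difference
  of these vectors for two vertices \<open>y\<close>, \<open>z\<close> at the same distance \<open>j\<close> from \<open>x\<close>. Always
  \<open>R e\<^sub>i = N (i + 1) e\<^sub>i\<^sub>+\<^sub>1\<close>. If \<open>j = 1\<close>, or if \<open>j = 2\<close> and \<open>x\<close>, \<open>y\<close>, \<open>z\<close> have pairwise the
  same intersection, then also \<open>L e\<^sub>i = (N D - N (i + 1)) e\<^sub>i\<^sub>-\<^sub>1\<close> and \<open>L e\<^sub>0 = 0\<close>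
  (\<open>raise_beyond_difference\<close>, \<open>lower_beyond_difference\<close>). The coefficients do not depend on \<open>j\<close>.
  So every element of \<open>Q\<close> preserves the span of the pairs \<open>(e\<^sub>i, e'\<^sub>i)\<close> built from the two
  cases. Each pair \<open>(g, h)\<close> in this span satisfies \<open>g y = h y'\<close>, where \<open>y\<close>, \<open>y'\<close> are the first vertices
  chosen in the two cases; the pair \<open>(E\<^sub>1\<^sup>* e\<^sub>0, E\<^sub>1\<^sup>* e'\<^sub>0) = (e\<^sub>0, 0)\<close> does not.

  The two geometric facts behind the coefficients are the following. A hyperplane \<open>M\<close> of a vertex \<open>u\<close> lies in
  exactly one further vertex \<open>u'\<close>, and \<open>u'\<close> is nearer to \<open>x\<close> than \<open>u\<close> if and only if \<open>M\<close> contains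
  \<open>u \<inter> x\<close>; hence the number of neighbors of \<open>u\<close> nearer to or farther from \<open>x\<close> and \<open>y\<close> depends
  only on dimensions of intersections (\<open>edge_step\<close>, \<open>card_nearer_both\<close>). And the vertices through a
  totally singular subspace \<open>P\<close> have a gate for each vertex \<open>u\<close> (\<open>gate\<close>), which shows that \<open>u\<close> distinguishes
  \<open>y\<close> from \<open>z\<close> in the second case only if its gate over \<open>y \<inter> z\<close> is \<open>y\<close> or \<open>z\<close>.\<close>

section \<open>Subspaces, hyperplanes and their numbers\<close>

context finite_dimensional_vector_space
begin

lemma in_span_subspace_iff: "subspace S \<Longrightarrow> x \<in> span S \<longleftrightarrow> x \<in> S"
  using span_eq_iff[of S] by blast

lemma dim_span_Un:
  assumes "subspace S" "subspace T"
  shows "dim (span (S \<union> T)) + dim (S \<inter> T) = dim S + dim T"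
proof -
  have "span (S \<union> T) = {x + y |x y. x \<in> S \<and> y \<in> T}"
    using assms by (simp add: span_Un in_span_subspace_iff)
  thus ?thesis using dim_sums_Int[OF assms] by simp
qed

lemma dim_Int_ge:
  assumes "subspace S" "subspace T" "subspace U" "S \<subseteq> U" "T \<subseteq> U"
  shows "dim S + dim T \<le> dim (S \<inter> T) + dim U"
proof -
  have "span (S \<union> T) \<subseteq> U" using assms by (simp add: span_minimal)
  hence "dim (span (S \<union> T)) \<le> dim U" by (rule dim_subset)
  thus ?thesis using dim_span_Un[OF assms(1,2)] by linarith
qed

definition hyperplanes :: "'b set \<Rightarrow> 'b set set" where
  "hyperplanes U = {M. subspace M \<and> M \<subseteq> U \<and> dim M + 1 = dim U}"

lemma span_insert_hyperplane:
  assumes "subspace U" "M \<in> hyperplanes U" "a \<in> U" "a \<notin> M"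
  shows "span (insert a M) = U"
proof (rule subspace_dim_equal)
  have M: "subspace M" "M \<subseteq> U" "dim M + 1 = dim U"
    using assms(2) by (auto simp: hyperplanes_def)
  hence "dim (insert a M) = dim U" using assms by (simp add: dim_insert in_span_subspace_iff)
  thus "dim U \<le> dim (span (insert a M))" by simp
  show "span (insert a M) \<subseteq> U" using assms M by (intro span_minimal) auto
qed (use assms in auto)

lemma dim_insert_subspace:
  assumes "subspace M" "a \<notin> M"
  shows "dim (insert a M) = dim M + 1"
  using assms by (simp add: dim_insert in_span_subspace_iff)

lemma exists_hyperplane:
  assumes "subspace U" "dim U > 0"
  obtains M where "M \<in> hyperplanes U"
proof -
  obtain M where "subspace M" "M \<subseteq> span U" "dim M = dim U - 1"
    using choose_subspace_of_subspace[of "dim U - 1" U] by auto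
  hence "M \<in> hyperplanes U"
    using assms by (auto simp: hyperplanes_def in_span_subspace_iff)
  thus ?thesis by (rule that)
qed

text \<open>Over any field a subspace of codimension 2 lies in at least three hyperplanes: if \<open>s\<close> and
  \<open>t\<close> span a complement, adjoin \<open>s\<close>, \<open>t\<close> or \<open>s + t\<close>.\<close>

lemma three_hyperplanes:
  assumes U: "subspace U" and H: "H \<in> hyperplanes U" and "dim U \<ge> 2"
  obtains P K K' where "P \<in> hyperplanes H" "P \<subseteq> K" "P \<subseteq> K'"
    "K \<in> hyperplanes U" "K' \<in> hyperplanes U" "K \<noteq> H" "K' \<noteq> H" "K \<noteq> K'"
proof -
  have H': "subspace H" "H \<subseteq> U" "dim H + 1 = dim U" using H by (auto simp: hyperplanes_def)
  obtain P where P: "P \<in> hyperplanes H"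
    using exists_hyperplane[OF H'(1)] H'(3) assms(3) by auto
  hence P': "subspace P" "P \<subseteq> H" "dim P + 1 = dim H" by (auto simp: hyperplanes_def)
  obtain s where s: "s \<in> H" "s \<notin> P" using P' by (metis less_irrefl less_add_one subsetI subset_antisym)
  obtain t where t: "t \<in> U" "t \<notin> H" using H' by (metis less_irrefl less_add_one subsetI subset_antisym)
  have st: "s + t \<in> U" "s + t \<notin> H"
    using s t H' subspace_add[OF U, of s t] subspace_diff[OF H'(1), of "s + t" s] by auto
  have K: "span (insert a P) \<in> hyperplanes U" "a \<in> span (insert a P)" "P \<subseteq> span (insert a P)"
    if "a \<in> U" "a \<notin> H" for a
  proof -
    have "a \<notin> P" using that P' by auto
    hence "dim (span (insert a P)) = dim P + 1" using P' by (simp add: dim_insert_subspace)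
    moreover have "span (insert a P) \<subseteq> U" using that P' H' U by (intro span_minimal) auto
    ultimately show "span (insert a P) \<in> hyperplanes U" using P' H' by (auto simp: hyperplanes_def)
    show "a \<in> span (insert a P)" "P \<subseteq> span (insert a P)"
      using span_superset[of "insert a P"] by auto
  qed
  let ?K = "span (insert t P)" and ?K' = "span (insert (s + t) P)"
  have "?K \<noteq> ?K'"
  proof
    assume eq: "?K = ?K'"
    hence "s + t \<in> ?K" using K(2)[OF st] by simp
    hence "s \<in> ?K" using K(2)[OF t] subspace_diff[of ?K "s + t" t] by simp
    moreover have "P \<in> hyperplanes ?K"
      using K(1)[OF t] P' H' K(3)[OF t] by (auto simp: hyperplanes_def)
    ultimately have "span (insert s P) = ?K" using s by (intro span_insert_hyperplane) auto
    moreover have "span (insert s P) \<subseteq> H" using s P' H' by (intro span_minimal) auto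
    ultimately show False using K(2)[OF t] t by auto
  qed
  moreover have "?K \<noteq> H" "?K' \<noteq> H" using K(2)[OF t] K(2)[OF st] t st by auto
  ultimately show ?thesis using that[OF P K(3)[OF t] K(3)[OF st] K(1)[OF t] K(1)[OF st]] by blast
qed

lemma automorphism_of_flags:
  assumes S: "subspace S" "subspace S'" "dim S = dim S'"
    and U: "subspace U" "subspace U'" "dim U = dim U'"
    and SU: "S \<subseteq> U" "S' \<subseteq> U'"
  obtains h where "Vector_Spaces.linear scale scale h" "bij h" "h ` S = S'" "h ` U = U'"
proof -
  interpret p: finite_dimensional_vector_space_pair scale Basis scale Basis by unfold_locales
  have ext: "\<exists>B C E. B \<subseteq> C \<and> C \<subseteq> E \<and> independent E \<and> span B = S \<and> span C = U \<and> span E = UNIV"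
    if sub: "subspace S" "subspace U" "S \<subseteq> U" for S U
  proof -
    obtain B where B: "B \<subseteq> S" "independent B" "span B = S"
      by (rule basis_subspace_exists[OF sub(1)])
    obtain C where C: "B \<subseteq> C" "C \<subseteq> U" "independent C" "U \<subseteq> span C"
      by (rule maximal_independent_subset_extend[of B U]) (use B sub in auto)
    obtain E where E: "C \<subseteq> E" "independent E" "UNIV \<subseteq> span E"
      by (rule maximal_independent_subset_extend[of C UNIV]) (use C in auto)
    have "span C = U" using C sub by (simp add: span_minimal subset_antisym)
    moreover have "span E = UNIV" using E(3) by blast
    ultimately show ?thesis using B(3) C(1) E(1,2) by blast
  qed
  obtain B C E where 1: "B \<subseteq> C" "C \<subseteq> E" "independent E" "span B = S" "span C = U" "span E = UNIV"
    using ext[OF S(1) U(1) SU(1)] by metis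
  obtain B' C' E' where 2: "B' \<subseteq> C'" "C' \<subseteq> E'" "independent E'" "span B' = S'" "span C' = U'"
    "span E' = UNIV"
    using ext[OF S(2) U(2) SU(2)] by metis
  have ind: "independent B" "independent C" "independent B'" "independent C'"
    using 1 2 by (meson independent_mono)+
  have fin: "finite B" "finite C" "finite E" "finite B'" "finite C'" "finite E'"
    using ind 1 2 by (auto intro: finiteI_independent)
  have card: "card B = card B'" "card C = card C'" "card E = card E'"
    using ind 1 2 S U dim_eq_card_independent dim_span by metis+
  obtain f1 where f1: "bij_betw f1 B B'" using card fin by (metis finite_same_card_bij)
  obtain f2 where f2: "bij_betw f2 (C - B) (C' - B')"
    using finite_same_card_bij[of "C - B" "C' - B'"] 1 2 fin card by (auto simp: card_Diff_subset)
  obtain f3 where f3: "bij_betw f3 (E - C) (E' - C')"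
    using finite_same_card_bij[of "E - C" "E' - C'"] 1 2 fin card by (auto simp: card_Diff_subset)
  define f where "f b = (if b \<in> B then f1 b else if b \<in> C then f2 b else f3 b)" for b
  have "bij_betw f B B'" using f1 by (rule bij_betw_cong[THEN iffD1, rotated]) (simp add: f_def)
  moreover have "bij_betw f (C - B) (C' - B')"
    using f2 by (rule bij_betw_cong[THEN iffD1, rotated]) (simp add: f_def)
  moreover have "bij_betw f (E - C) (E' - C')"
    using f3 1 by (intro bij_betw_cong[THEN iffD1, OF _ f3]) (auto simp: f_def)
  ultimately have fB: "bij_betw f B B'" and fC: "bij_betw f C C'" and fE: "bij_betw f E E'"
  proof -
    assume a: "bij_betw f B B'" "bij_betw f (C - B) (C' - B')" "bij_betw f (E - C) (E' - C')"
    show "bij_betw f B B'" by fact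
    have eqs: "B \<union> (C - B) = C" "B' \<union> (C' - B') = C'" "C \<union> (E - C) = E" "C' \<union> (E' - C') = E'"
      using 1 2 by auto
    show c: "bij_betw f C C'" using bij_betw_combine[OF a(1,2)] eqs by auto
    show "bij_betw f E E'" using bij_betw_combine[OF c a(3)] eqs by auto
  qed
  obtain h where h: "Vector_Spaces.linear scale scale h" "\<And>b. b \<in> E \<Longrightarrow> h b = f b"
    using p.linear_independent_extend[OF 1(3)] by metis
  interpret h: Vector_Spaces.linear scale scale h by (rule h)
  have im: "h ` B = B'" "h ` C = C'" "h ` E = E'"
  proof -
    have "h ` A = f ` A" if "A \<subseteq> E" for A using that h(2) by (intro image_cong) auto
    thus "h ` B = B'" "h ` C = C'" "h ` E = E'"
      using fB fC fE 1(1,2) by (auto simp: bij_betw_def)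
  qed
  have span: "h ` S = S'" "h ` U = U'" "h ` UNIV = UNIV"
    using im 1 2 h.span_image by metis+
  have "bij h"
    using span(3) linear_surj_imp_inj[OF h(1)] by (simp add: bij_def)
  thus ?thesis using that h(1) span by blast
qed

text \<open>Over a field with \<open>q\<close> elements the common value is the \<open>q\<close>-integer of the codimension of
  \<open>S\<close> in \<open>U\<close>; it enters the argument only as a number that is determined by dimensions. A linear
  automorphism matching the two flags carries the hyperplanes over.\<close>

lemma card_hyperplanes_over_eq:
  assumes S: "subspace S" "subspace S'" "dim S = dim S'"
    and U: "subspace U" "subspace U'" "dim U = dim U'"
    and SU: "S \<subseteq> U" "S' \<subseteq> U'"
  shows "card {M \<in> hyperplanes U. S \<subseteq> M} = card {M \<in> hyperplanes U'. S' \<subseteq> M}"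
proof -
  interpret p: finite_dimensional_vector_space_pair scale Basis scale Basis by unfold_locales
  obtain h where h: "Vector_Spaces.linear scale scale h" "bij h" "h ` S = S'" "h ` U = U'"
    using automorphism_of_flags[OF assms] by metis
  interpret h: Vector_Spaces.linear scale scale h by (rule h)
  have inj: "inj h" and surj: "surj h" using h(2) by (auto simp: bij_def)
  have dim: "dim (h ` M) = dim M" for M
    using p.dim_image_eq[OF h(1)] inj by (meson inj_on_subset subset_UNIV)
  have "(`) h ` {M \<in> hyperplanes U. S \<subseteq> M} = {M \<in> hyperplanes U'. S' \<subseteq> M}" (is "_ ` ?A = ?B")
  proof (intro equalityI subsetI)
    fix M assume "M \<in> (`) h ` ?A"
    then obtain L where L: "subspace L" "L \<subseteq> U" "dim L + 1 = dim U" "S \<subseteq> L" "M = h ` L"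
      by (auto simp: hyperplanes_def)
    have "subspace M" using L(1,5) h.subspace_image by blast
    moreover have "dim M + 1 = dim U'" using L(3,5) dim U(3) by simp
    moreover have "M \<subseteq> U'" "S' \<subseteq> M" using L(2,4,5) h(3,4) by auto
    ultimately show "M \<in> ?B" by (simp add: hyperplanes_def)
  next
    fix M assume M: "M \<in> ?B"
    let ?N = "h -` M"
    have im: "h ` ?N = M" using surj by simp
    have "subspace ?N" using M h.subspace_vimage by (auto simp: hyperplanes_def)
    moreover have "dim ?N = dim M" using dim[of ?N] im by simp
    moreover have "?N \<subseteq> U"
    proof
      fix v assume "v \<in> ?N"
      hence "h v \<in> h ` U" using M h(4) by (auto simp: hyperplanes_def)
      thus "v \<in> U" by (simp only: inj_image_mem_iff[OF inj])
    qed
    moreover have "S \<subseteq> ?N" using M h(3) by auto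
    ultimately have "?N \<in> ?A" using M U(3) by (auto simp: hyperplanes_def)
    thus "M \<in> (`) h ` ?A" using im by blast
  qed
  moreover have "inj_on ((`) h) ?A" using inj by (simp add: inj_on_def inj_image_eq_iff)
  ultimately show ?thesis using card_image[of "(`) h" ?A] by simp
qed

lemma exists_hyperplane_over:
  assumes "subspace S" "subspace U" "S \<subset> U"
  obtains M where "M \<in> hyperplanes U" "S \<subseteq> M"
proof -
  obtain B where B: "B \<subseteq> S" "independent B" "span B = S"
    by (rule basis_subspace_exists[OF assms(1)])
  obtain C where C: "B \<subseteq> C" "C \<subseteq> U" "independent C" "U \<subseteq> span C"
    by (rule maximal_independent_subset_extend[of B U]) (use B assms in auto)
  have U: "span C = U" using C assms by (simp add: span_minimal subset_antisym)
  have "\<not> C \<subseteq> B" using span_mono[of C B] B(3) U assms(3) by auto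
  then obtain c where c: "c \<in> C" "c \<notin> B" by blast
  have fin: "finite C" using C(3) by (rule finiteI_independent)
  have "independent (C - {c})" using C(3) by (rule independent_mono) auto
  hence "dim (span (C - {c})) = card C - 1" using c fin by (simp add: dim_eq_card_independent)
  moreover have "dim U = card C" using U C(3) dim_span_eq_card_independent by blast
  moreover have "card C > 0" using c fin card_gt_0_iff by blast
  moreover have "S \<subseteq> span (C - {c})" using B C c by (metis Diff_empty span_mono subset_Diff_insert)
  moreover have "span (C - {c}) \<subseteq> U" using U by (metis Diff_subset span_mono)
  ultimately show ?thesis by (intro that[of "span (C - {c})"]) (auto simp: hyperplanes_def)
qed

lemma dim_le_dim_Int_kernel:
  assumes "subspace W" and lin: "Vector_Spaces.linear scale (*) \<phi>"
  shows "dim W \<le> dim (W \<inter> {w. \<phi> w = 0}) + 1"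
proof (cases "\<exists>w\<in>W. \<phi> w \<noteq> 0")
  case False
  hence "W \<inter> {w. \<phi> w = 0} = W" by auto
  thus ?thesis by simp
next
  case True
  then obtain a where a: "a \<in> W" "\<phi> a \<noteq> 0" by blast
  interpret \<phi>: Vector_Spaces.linear scale "(*)" \<phi> by (rule lin)
  let ?K = "W \<inter> {w. \<phi> w = 0}"
  have "W \<subseteq> span (insert a ?K)"
  proof
    fix w assume w: "w \<in> W"
    let ?c = "\<phi> w / \<phi> a"
    have "w - scale ?c a \<in> ?K"
      using w a assms(1) by (auto simp: \<phi>.diff \<phi>.scale intro!: subspace_diff subspace_scale)
    hence "(w - scale ?c a) + scale ?c a \<in> span (insert a ?K)"
      by (intro span_add span_scale) (auto intro: span_base)
    thus "w \<in> span (insert a ?K)" by simp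
  qed
  hence "dim W \<le> dim (insert a ?K)" by (metis dim_mono)
  also have "\<dots> \<le> dim ?K + 1" by (simp add: dim_insert)
  finally show ?thesis .
qed

lemma finite_span_finite_field:
  assumes "finite (UNIV :: 'a set)"
  shows "finite (UNIV :: 'b set)"
proof -
  have "finite (span S)" if "finite S" for S
    using that
  proof induction
    case (insert a S)
    have "span (insert a S) \<subseteq> (\<lambda>(c, v). v + scale c a) ` (UNIV \<times> span S)"
    proof
      fix v assume "v \<in> span (insert a S)"
      then obtain c where "v - scale c a \<in> span S" by (auto simp: span_insert)
      thus "v \<in> (\<lambda>(c, v). v + scale c a) ` (UNIV \<times> span S)"
        by (intro image_eqI[of _ _ "(c, v - scale c a)"]) auto
    qed
    thus ?case using insert.IH assms by (meson finite_SigmaI finite_imageI finite_subset)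
  qed simp
  thus ?thesis using finite_Basis span_Basis by metis
qed

end

section \<open>Polar spaces of hyperbolic type\<close>

locale hyperbolic_space = finite_dimensional_vector_space scale Basis
  for scale :: "'k::{field,finite} \<Rightarrow> 'v::ab_group_add \<Rightarrow> 'v" and Basis :: "'v set" +
  fixes f :: "'v \<Rightarrow> 'k" and D :: nat
  assumes quadratic: "quadratic_form scale f"
    and nondegenerate: "nondegenerate f"
    and dim_space: "card Basis = 2 * D"
    and witt: "witt_index scale f = D"
    and D_ge_2: "D \<ge> 2"
begin

abbreviation form :: "'v \<Rightarrow> 'v \<Rightarrow> 'k" where "form \<equiv> polar_form f"

abbreviation singular :: "'v set \<Rightarrow> bool" where "singular \<equiv> totally_singular scale f"

definition perp :: "'v set \<Rightarrow> 'v set" where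
  "perp S = {v. \<forall>s\<in>S. form s v = 0}"

lemma finite_vectors: "finite (A :: 'v set)"
  using finite_span_finite_field finite_subset by (metis finite subset_UNIV)

lemma form_commute: "form u v = form v u"
  by (simp add: polar_form_def algebra_simps)

lemma form_linear: "Vector_Spaces.linear scale (*) (form u)"
  using quadratic by (simp add: quadratic_form_def)

lemma form_right:
  "form u (v + w) = form u v + form u w" "form u (v - w) = form u v - form u w"
  "form u (scale c v) = c * form u v" "form u 0 = 0"
proof -
  interpret Vector_Spaces.linear scale "(*)" "form u" by (rule form_linear)
  show "form u (v + w) = form u v + form u w" "form u (v - w) = form u v - form u w"
    "form u (scale c v) = c * form u v" "form u 0 = 0"
    by (simp_all add: add diff scale)
qed

lemma form_left:
  "form (v + w) u = form v u + form w u" "form (v - w) u = form v u - form w u"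
  "form (scale c v) u = c * form v u" "form 0 u = 0"
  using form_right form_commute by metis+

lemma quad_scale: "f (scale c v) = c\<^sup>2 * f v"
  using quadratic by (simp add: quadratic_form_def)

lemma quad_zero: "f 0 = 0"
  using quad_scale[of 0 0] by simp

lemma quad_add: "f (u + v) = f u + f v + form u v"
  by (simp add: polar_form_def)

lemma subspace_perp: "subspace (perp S)"
  by (rule subspaceI) (auto simp: perp_def form_right)

lemma perp_span: "perp (span S) = perp S"
proof
  show "perp (span S) \<subseteq> perp S" using span_base by (auto simp: perp_def)
  show "perp S \<subseteq> perp (span S)"
  proof
    fix v assume v: "v \<in> perp S"
    have "form s v = 0" if "s \<in> span S" for s
      using that v by (induction rule: span_induct_alt) (auto simp: perp_def form_left)
    thus "v \<in> perp (span S)" by (auto simp: perp_def)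
  qed
qed

lemma singular_subspace: "singular W \<Longrightarrow> subspace W"
  and singular_quad: "singular W \<Longrightarrow> w \<in> W \<Longrightarrow> f w = 0"
  by (auto simp: totally_singular_def)

lemma singular_form: "singular W \<Longrightarrow> v \<in> W \<Longrightarrow> w \<in> W \<Longrightarrow> form v w = 0"
  using singular_subspace[of W] singular_quad[of W] subspace_add[of W v w]
  by (simp add: polar_form_def)

lemma singular_sub: "singular W \<Longrightarrow> subspace S \<Longrightarrow> S \<subseteq> W \<Longrightarrow> singular S"
  by (auto simp: totally_singular_def)

lemma singular_span_Un:
  assumes "singular S" "singular T" "T \<subseteq> perp S"
  shows "singular (span (S \<union> T))"
proof -
  have "f w = 0" if w: "w \<in> span (S \<union> T)" for w
  proof -
    obtain s t where "w = s + t" "s \<in> S" "t \<in> T"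
      using w unfolding span_Un mem_Collect_eq
        in_span_subspace_iff[OF singular_subspace[OF assms(1)]]
        in_span_subspace_iff[OF singular_subspace[OF assms(2)]] by blast
    thus ?thesis using assms by (auto simp: quad_add singular_quad perp_def)
  qed
  thus ?thesis by (simp add: totally_singular_def)
qed

lemma singular_span_insert:
  assumes "singular S" "f a = 0" "a \<in> perp S"
  shows "singular (span (insert a S))"
proof -
  have "f w = 0" if w: "w \<in> span (insert a S)" for w
  proof -
    obtain c where c: "w - scale c a \<in> S"
      using w assms(1) by (auto simp: span_insert in_span_subspace_iff singular_subspace)
    hence "f (w - scale c a) = 0" "form (w - scale c a) a = 0"
      using assms by (auto simp: singular_quad perp_def)
    thus ?thesis
      using quad_add[of "w - scale c a" "scale c a"] assms(2) by (simp add: quad_scale form_right)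
  qed
  thus ?thesis by (simp add: totally_singular_def)
qed

lemma finite_singular_dims: "finite (dim ` {W. singular W})"
proof -
  have "finite (UNIV :: 'v set set)" using finite_vectors by (simp add: Finite_Set.finite_set)
  thus ?thesis by (meson finite_imageI finite_subset subset_UNIV)
qed

lemma singular_dim_le: "singular W \<Longrightarrow> dim W \<le> D"
  using finite_singular_dims witt by (auto simp: witt_index_def intro: Max_ge)

lemma exists_singular_dim_D: obtains W where "singular W" "dim W = D"
proof -
  have "singular {0}" by (simp add: totally_singular_def quad_zero)
  hence "Max (dim ` {W. singular W}) \<in> dim ` {W. singular W}"
    using finite_singular_dims by (intro Max_in) auto
  thus ?thesis using that witt by (auto simp: witt_index_def)
qed

text \<open>The vectors of \<open>Z\<close> orthogonal to all of \<open>W\<close> impose no condition on \<open>W\<close>, and each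
  member of a basis of a complement to them in \<open>Z\<close> lowers the dimension by at most one. The
  inequality is used in both directions \<open>W \<leftrightarrow> Z\<close> below.\<close>

lemma dim_Int_perp_ge:
  assumes W: "subspace W" and Z: "subspace Z"
  shows "dim W + dim (Z \<inter> perp W) \<le> dim (W \<inter> perp Z) + dim Z"
proof -
  have sub: "subspace (Z \<inter> perp W)" using Z by (simp add: subspace_inter subspace_perp)
  obtain B where B: "B \<subseteq> Z \<inter> perp W" "independent B" "span B = Z \<inter> perp W"
    by (rule basis_subspace_exists[OF sub])
  obtain C where C: "B \<subseteq> C" "C \<subseteq> Z" "independent C" "Z \<subseteq> span C"
    by (rule maximal_independent_subset_extend[of B Z]) (use B in auto)
  have "span C = Z" using C Z by (simp add: span_minimal subset_antisym)
  hence perpZ: "perp Z = perp C" using perp_span[of C] by simp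
  have fin: "finite C" using C(3) by (rule finiteI_independent)
  have step: "dim W \<le> dim (W \<inter> perp S) + card S" if "finite S" for S
    using that
  proof induction
    case (insert s S)
    have "dim (W \<inter> perp S) \<le> dim (W \<inter> perp S \<inter> {w. form s w = 0}) + 1"
      using W form_linear by (intro dim_le_dim_Int_kernel) (simp_all add: subspace_inter subspace_perp)
    also have "W \<inter> perp S \<inter> {w. form s w = 0} = W \<inter> perp (insert s S)"
      by (auto simp: perp_def)
    finally show ?case using insert by simp
  qed (simp add: perp_def)
  have "form b w = 0" if "b \<in> B" "w \<in> W" for b w
    using that B(1) form_commute[of b w] by (auto simp: perp_def)
  hence "W \<inter> perp (C - B) = W \<inter> perp C" by (auto simp: perp_def)
  hence "W \<inter> perp (C - B) = W \<inter> perp Z" by (simp add: perpZ)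
  moreover have "card (C - B) = dim Z - dim (Z \<inter> perp W)"
    using B C fin \<open>span C = Z\<close> finite_subset[OF C(1) fin]
    by (metis card_Diff_subset dim_span_eq_card_independent)
  moreover have "dim (Z \<inter> perp W) \<le> dim Z" by (simp add: dim_subset)
  ultimately show ?thesis using step[of "C - B"] fin by simp
qed

text \<open>The radical of the form meets \<open>W\<close> trivially by nondegeneracy, so
  \<open>perp W\<close> has dimension exactly \<open>2 * D - D\<close>.\<close>

lemma perp_maximal:
  assumes "singular W" "dim W = D"
  shows "perp W = W"
proof -
  have W: "subspace W" using assms singular_subspace by blast
  have "W \<inter> perp UNIV \<subseteq> {0}"
    using nondegenerate assms singular_quad by (auto simp: perp_def nondegenerate_def)
  hence "dim (W \<inter> perp UNIV) = 0" by simp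
  hence "dim (perp W) \<le> dim W"
    using dim_Int_perp_ge[OF W subspace_UNIV] assms(2) dim_UNIV dim_space
    unfolding Int_UNIV_left by linarith
  moreover have "W \<subseteq> perp W" using assms(1) singular_form by (auto simp: perp_def)
  ultimately show ?thesis using subspace_dim_equal[OF W subspace_perp] by blast
qed

text \<open>Taking \<open>P\<close> maximal, this gives Witt's theorem that all maximal totally singular subspaces
  have dimension \<open>D\<close>. For smaller \<open>P\<close> the subspace \<open>g\<close> is the gate of \<open>u\<close> in the set of vertices
  through \<open>P\<close>.\<close>

lemma projection_dim:
  assumes "singular u" "dim u = D" "singular P"
  defines "g \<equiv> span (P \<union> (u \<inter> perp P))"
  shows "singular g" "dim g = D"
proof -
  have sub: "subspace u" "subspace P" "subspace (u \<inter> perp P)"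
    using assms singular_subspace subspace_perp by (simp_all add: subspace_inter)
  have "singular (u \<inter> perp P)" using assms(1) sub(3) singular_sub by blast
  thus g: "singular g" unfolding g_def using assms(3) by (intro singular_span_Un) auto
  have "u \<inter> P \<subseteq> P \<inter> perp u" using assms(1) singular_form by (auto simp: perp_def)
  hence "dim (u \<inter> P) \<le> dim (P \<inter> perp u)" by (rule dim_subset)
  moreover have "P \<inter> (u \<inter> perp P) = u \<inter> P" using assms(3) singular_form by (auto simp: perp_def)
  hence "dim g + dim (u \<inter> P) = dim P + dim (u \<inter> perp P)"
    using dim_span_Un[OF sub(2,3)] by (simp add: g_def)
  ultimately have "dim g \<ge> D" using dim_Int_perp_ge[OF sub(1,2)] assms(2) by linarith
  thus "dim g = D" using singular_dim_le[OF g] by linarith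
qed

definition X :: "'v set set" where "X = dual_polar_vertices scale f"

definition E :: "'v set rel" where "E = dual_polar_edges scale f D"

lemma X_iff: "W \<in> X \<longleftrightarrow> singular W \<and> dim W = D"
proof
  assume W: "W \<in> X"
  obtain u where u: "singular u" "dim u = D" by (rule exists_singular_dim_D)
  have "singular W" using W by (simp add: X_def dual_polar_vertices_def)
  note g = projection_dim[OF u this]
  have "W \<subseteq> span (W \<union> (u \<inter> perp W))" using span_superset[of "W \<union> (u \<inter> perp W)"] by blast
  hence "span (W \<union> (u \<inter> perp W)) = W"
    using g(1) W by (auto simp: X_def dual_polar_vertices_def)
  with g show "singular W \<and> dim W = D" by simp
next
  assume W: "singular W \<and> dim W = D"
  have "W' = W" if "singular W'" "W \<subseteq> W'" for W'
    using subspace_dim_equal[of W W'] that W singular_dim_le[of W'] singular_subspace by auto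
  thus "W \<in> X" using W by (auto simp: X_def dual_polar_vertices_def)
qed

lemma X_D:
  assumes "W \<in> X"
  shows "singular W" "dim W = D" "subspace W"
  using assms X_iff singular_subspace by auto

lemma X_eqI: "u \<in> X \<Longrightarrow> v \<in> X \<Longrightarrow> u \<subseteq> v \<Longrightarrow> u = v"
  using subspace_dim_equal[of u v] X_D by simp

lemma finite_X: "finite X"
proof -
  have "finite (UNIV :: 'v set set)" using finite_vectors by (simp add: Finite_Set.finite_set)
  thus ?thesis by (meson finite_subset subset_UNIV)
qed

lemma hyperplane_singular: "u \<in> X \<Longrightarrow> M \<in> hyperplanes u \<Longrightarrow> singular M"
  using X_D(1) singular_sub[of u M] by (simp add: hyperplanes_def)

text \<open>The quotient \<open>perp M / M\<close> is a hyperbolic plane, which has two singular points. One of them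
  is \<open>u\<close>; the other is obtained from any \<open>c \<in> perp M\<close> outside \<open>u\<close> by subtracting the multiple of
  a vector \<open>a\<close> of \<open>u\<close> that makes it singular.\<close>

lemma exists_opposite:
  assumes u: "u \<in> X" and M: "M \<in> hyperplanes u"
  obtains v where "v \<in> X" "v \<noteq> u" "M \<subseteq> v"
proof -
  have M': "subspace M" "M \<subseteq> u" "dim M + 1 = dim u" using M by (auto simp: hyperplanes_def)
  have sM: "singular M" using u M by (rule hyperplane_singular)
  obtain a where a: "a \<in> u" "a \<notin> M"
    using M' by (metis less_irrefl less_add_one subsetI subset_antisym)
  have "dim (UNIV \<inter> perp M) \<ge> D + 1"
    using dim_Int_perp_ge[OF subspace_UNIV M'(1)] M'(3) X_D(2)[OF u] dim_UNIV dim_space by linarith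
  hence "\<not> perp M \<subseteq> u" using dim_subset[of "perp M" u] X_D(2)[OF u] by auto
  then obtain c where c: "c \<in> perp M" "c \<notin> u" by blast
  have ac: "form a c \<noteq> 0"
  proof
    assume "form a c = 0"
    hence "c \<in> perp (span (insert a M))" using c(1) unfolding perp_span by (auto simp: perp_def)
    hence "c \<in> perp u" using span_insert_hyperplane[OF X_D(3)[OF u] M a] by simp
    thus False using perp_maximal X_D[OF u] c(2) by simp
  qed
  \<comment> \<open>since \<open>f (c - t a) = f c - t (form c a)\<close> for the singular vector \<open>a\<close>\<close>
  define c' where "c' = c - scale (f c / form a c) a"
  have "f c = f c' + 0 + f c"
  proof -
    have "form c' (scale (f c / form a c) a) = f c"
      using ac X_D[OF u] a singular_form[of u a a]
      by (simp add: c'_def form_right form_left form_commute[of c a])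
    moreover have "f (scale (f c / form a c) a) = 0"
      using singular_quad[OF X_D(1)[OF u] a(1)] by (simp add: quad_scale)
    moreover have "c = c' + scale (f c / form a c) a" by (simp add: c'_def)
    ultimately show ?thesis using quad_add[of c' "scale (f c / form a c) a"] by simp
  qed
  hence fc': "f c' = 0" by simp
  have "a \<in> perp M" using M' a singular_form[OF X_D(1)[OF u]] by (auto simp: perp_def)
  hence pc': "c' \<in> perp M" unfolding c'_def using c(1)
    by (intro subspace_diff subspace_scale subspace_perp)
  have c'u: "c' \<notin> u"
  proof
    assume "c' \<in> u"
    hence "c' + scale (f c / form a c) a \<in> u"
      using a X_D(3)[OF u] by (intro subspace_add subspace_scale)
    thus False using c(2) by (simp add: c'_def)
  qed
  let ?v = "span (insert c' M)"
  have "c' \<notin> M" using c'u M' by auto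
  hence "?v \<in> X"
    using singular_span_insert[OF sM fc' pc'] M' X_D(2)[OF u] by (simp add: X_iff dim_insert_subspace)
  moreover have "c' \<in> ?v" "M \<subseteq> ?v" using span_superset[of "insert c' M"] by auto
  ultimately show ?thesis using that c'u by blast
qed

lemma Int_eq_hyperplane:
  assumes "u \<in> X" "v \<in> X" "v \<noteq> u" "M \<in> hyperplanes u" "M \<subseteq> v"
  shows "u \<inter> v = M"
proof -
  have M: "subspace M" "M \<subseteq> u" "dim M + 1 = D"
    using assms(1,4) X_D by (auto simp: hyperplanes_def)
  have sub: "subspace (u \<inter> v)" using assms X_D by (simp add: subspace_inter)
  have "dim (u \<inter> v) \<noteq> D"
    using subspace_dim_equal[OF sub X_D(3)[OF assms(1)]] X_D(2)[OF assms(1)] X_eqI[OF assms(1,2)] assms(3)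
    by (metis inf_le1 inf_le2 order_refl)
  moreover have "dim (u \<inter> v) \<le> D" using dim_subset[of "u \<inter> v" u] X_D(2)[OF assms(1)] by simp
  ultimately have "M = u \<inter> v"
    using M assms(5) by (intro subspace_dim_equal sub) auto
  thus ?thesis by simp
qed

text \<open>Let \<open>a\<close>, \<open>c\<close>, \<open>e\<close> complement \<open>M\<close> in \<open>u\<close>, \<open>v\<close>, \<open>w\<close>. Subtracting a multiple of \<open>c\<close>
  makes \<open>e\<close> orthogonal to \<open>u\<close>, hence a vector of \<open>u\<close>; singularity of \<open>e\<close> then makes that vector
  orthogonal to \<open>v\<close> as well.\<close>

lemma opposite_unique:
  assumes u: "u \<in> X" and M: "M \<in> hyperplanes u"
    and v: "v \<in> X" "v \<noteq> u" "M \<subseteq> v" and w: "w \<in> X" "w \<noteq> u" "M \<subseteq> w"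
  shows "v = w"
proof -
  have M': "subspace M" "M \<subseteq> u" "dim M + 1 = D"
    using M X_D(2)[OF u] by (auto simp: hyperplanes_def)
  have Mv: "M \<in> hyperplanes v" and Mw: "M \<in> hyperplanes w"
    using M' v w X_D(2) by (auto simp: hyperplanes_def)
  have ex: "\<exists>a. a \<in> y \<and> a \<notin> M" if "y \<in> X" for y
    using M' X_D(2)[OF that] dim_subset[of y M] by fastforce
  obtain a where a: "a \<in> u" "a \<notin> M" using ex u by blast
  obtain c where c: "c \<in> v" "c \<notin> M" using ex v by blast
  obtain e where e: "e \<in> w" "e \<notin> M" using ex w by blast
  have "c \<notin> u" "e \<notin> u"
    using Int_eq_hyperplane[OF u v(1,2) M v(3)] Int_eq_hyperplane[OF u w(1,2) M w(3)] c e by auto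
  have perpM: "z \<in> perp M" if "z \<in> y" "y \<in> X" "M \<subseteq> y" for z y
    using that singular_form[OF X_D(1)[OF that(2)]] by (auto simp: perp_def)
  have perpI: "z \<in> y" if "z \<in> perp M" "form b z = 0" "b \<in> y" "b \<notin> M" "y \<in> X" "M \<in> hyperplanes y"
    for z y b
  proof -
    have "z \<in> perp (span (insert b M))" using that(1,2) unfolding perp_span by (auto simp: perp_def)
    hence "z \<in> perp y" using span_insert_hyperplane[OF X_D(3)[OF that(5)] that(6,3,4)] by simp
    thus "z \<in> y" using perp_maximal X_D[OF that(5)] by simp
  qed
  have cM: "c \<in> perp M" "e \<in> perp M" using perpM c e v w by auto
  have ac: "form a c \<noteq> 0" using perpI[OF cM(1) _ a u M] \<open>c \<notin> u\<close> by blast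
  have ae: "form a e \<noteq> 0" using perpI[OF cM(2) _ a u M] \<open>e \<notin> u\<close> by blast
  \<comment> \<open>the factor that makes \<open>z\<close> orthogonal to \<open>a\<close>\<close>
  define k where "k = form a e / form a c"
  define z where "z = e - scale k c"
  have zM: "z \<in> perp M" unfolding z_def using cM
    by (intro subspace_diff subspace_scale subspace_perp)
  have zu: "z \<in> u" using perpI[OF zM _ a u M] ac by (simp add: z_def k_def form_right)
  have "e = scale k c + z" by (simp add: z_def)
  hence "f e = f (scale k c) + f z + k * form c z" by (simp add: quad_add form_left)
  moreover have "f e = 0" "f (scale k c) = 0" "f z = 0"
    using singular_quad X_D(1) u v(1) w(1) c(1) e(1) zu by (auto simp: quad_scale)
  moreover have "k \<noteq> 0" using ac ae by (simp add: k_def)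
  ultimately have "form c z = 0" by simp
  hence "z \<in> v" using perpI[OF zM _ c v(1) Mv] by blast
  hence "e \<in> v" unfolding \<open>e = scale k c + z\<close> using c X_D(3)[OF v(1)]
    by (intro subspace_add subspace_scale)
  hence "span (insert e M) \<subseteq> v" using v X_D(3) by (intro span_minimal) auto
  thus "v = w" using span_insert_hyperplane[OF X_D(3)[OF w(1)] Mw e] X_eqI[OF w(1) v(1)] by simp
qed

section \<open>Distance and gates\<close>

definition delta :: "'v set \<Rightarrow> 'v set \<Rightarrow> nat" where
  "delta u v = D - dim (u \<inter> v)"

lemma delta_commute: "delta u v = delta v u"
  by (simp add: delta_def Int_commute)

lemma dim_Int_eq: "u \<in> X \<Longrightarrow> dim (u \<inter> v) + delta u v = D"
  using dim_subset[of "u \<inter> v" u] X_D(2)[of u] by (simp add: delta_def)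

lemma delta_eq_0_iff: "u \<in> X \<Longrightarrow> v \<in> X \<Longrightarrow> delta u v = 0 \<longleftrightarrow> u = v"
proof
  assume uv: "u \<in> X" "v \<in> X" "delta u v = 0"
  have "dim u \<le> dim (u \<inter> v)" using dim_Int_eq[OF uv(1), of v] uv X_D(2) by simp
  moreover have "subspace (u \<inter> v)" using uv X_D(3) by (simp add: subspace_inter)
  ultimately have "u \<inter> v = u" using uv X_D(3) by (intro subspace_dim_equal) auto
  thus "u = v" using X_eqI uv by blast
qed (use dim_Int_eq[of u u] X_D(2) in auto)

lemma delta_triangle:
  assumes "u \<in> X" "v \<in> X" "w \<in> X"
  shows "delta u w \<le> delta u v + delta v w"
proof -
  have sub: "subspace (v \<inter> u)" "subspace (v \<inter> w)"
    using assms X_D(3) by (simp_all add: subspace_inter)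
  have "dim (v \<inter> u) + dim (v \<inter> w) \<le> dim ((v \<inter> u) \<inter> (v \<inter> w)) + D"
    using dim_Int_ge[OF sub X_D(3)[OF assms(2)]] X_D(2)[OF assms(2)] by simp
  moreover have "dim ((v \<inter> u) \<inter> (v \<inter> w)) \<le> dim (u \<inter> w)" by (intro dim_subset) auto
  ultimately show ?thesis
    using dim_Int_eq[OF assms(1), of w] dim_Int_eq[OF assms(2), of u] dim_Int_eq[OF assms(2), of w]
      delta_commute[of u v] by linarith
qed

text \<open>The subspace \<open>P + (u \<inter> perp P)\<close> is the vertex through \<open>P\<close> nearest to \<open>u\<close>, and geodesics
  from \<open>u\<close> to the other vertices through \<open>P\<close> can be taken through it: residues are gated.\<close>

lemma gate:
  assumes u: "u \<in> X" and P: "singular P"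
  obtains g where "g \<in> X" "P \<subseteq> g"
    "\<And>v. v \<in> X \<Longrightarrow> P \<subseteq> v \<Longrightarrow> u \<inter> v \<subseteq> g"
    "\<And>v. v \<in> X \<Longrightarrow> P \<subseteq> v \<Longrightarrow> delta u v = delta u g + delta g v"
proof -
  define g where "g = span (P \<union> (u \<inter> perp P))"
  have g: "g \<in> X" using projection_dim[OF X_D(1,2)[OF u] P] by (simp add: X_iff g_def)
  have sup: "P \<subseteq> g" "u \<inter> perp P \<subseteq> g"
    using span_superset[of "P \<union> (u \<inter> perp P)"] by (auto simp: g_def)
  have cut: "u \<inter> v \<subseteq> g" if v: "v \<in> X" "P \<subseteq> v" for v
  proof -
    have "v \<subseteq> perp P" using v singular_form[OF X_D(1)[OF v(1)]] by (auto simp: perp_def)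
    thus ?thesis using sup by auto
  qed
  have "delta u v = delta u g + delta g v" if v: "v \<in> X" "P \<subseteq> v" for v
  proof -
    have sub: "subspace (u \<inter> g)" "subspace (g \<inter> v)"
      using u g v X_D(3) by (simp_all add: subspace_inter)
    have "span ((u \<inter> g) \<union> (g \<inter> v)) = g"
    proof
      show "span ((u \<inter> g) \<union> (g \<inter> v)) \<subseteq> g" using X_D(3)[OF g] by (intro span_minimal) auto
      show "g \<subseteq> span ((u \<inter> g) \<union> (g \<inter> v))"
        unfolding g_def using sup v unfolding g_def by (intro span_mono) auto
    qed
    moreover have "(u \<inter> g) \<inter> (g \<inter> v) = u \<inter> v" using cut[OF v] by auto
    ultimately have "D + dim (u \<inter> v) = dim (u \<inter> g) + dim (g \<inter> v)"
      using dim_span_Un[OF sub] X_D(2)[OF g] by simp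
    thus ?thesis
      using dim_Int_eq[OF u, of v] dim_Int_eq[OF u, of g] dim_Int_eq[OF g, of v] by linarith
  qed
  thus ?thesis using that g sup cut by blast
qed

lemma E_iff: "(u, v) \<in> E \<longleftrightarrow> u \<in> X \<and> v \<in> X \<and> delta u v = 1"
  using D_ge_2 by (auto simp: E_def X_def[symmetric] dual_polar_edges_def delta_def)

lemma E_sym: "(u, v) \<in> E \<longleftrightarrow> (v, u) \<in> E"
  using E_iff delta_commute by metis

lemma E_hyperplane: "(u, v) \<in> E \<Longrightarrow> u \<inter> v \<in> hyperplanes u"
  using dim_Int_eq[of u v] X_D by (auto simp: E_iff hyperplanes_def subspace_inter)

lemma E_hyperplaneI:
  assumes "u \<in> X" "v \<in> X" "v \<noteq> u" "M \<in> hyperplanes u" "M \<subseteq> v"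
  shows "(u, v) \<in> E" "u \<inter> v = M"
proof -
  show eq: "u \<inter> v = M" using Int_eq_hyperplane assms by blast
  hence "dim (u \<inter> v) + 1 = D" using assms(1,4) X_D(2) by (simp add: hyperplanes_def)
  thus "(u, v) \<in> E" using assms(1,2) by (simp add: E_iff delta_def)
qed

text \<open>The two ends of an edge are the only vertices through their intersection, so one
  of them is the gate of \<open>v\<close>. In particular the graph is bipartite, and a neighbor \<open>u'\<close> of \<open>u\<close> is
  nearer to \<open>v\<close> exactly if the hyperplane \<open>u \<inter> u'\<close> contains \<open>u \<inter> v\<close>; this
  turns all neighbor counts into hyperplane counts.\<close>

lemma edge_step:
  assumes e: "(u, u') \<in> E" and v: "v \<in> X"
  shows "u \<inter> v \<subseteq> u' \<and> delta v u = delta v u' + 1 \<or> \<not> u \<inter> v \<subseteq> u' \<and> delta v u' = delta v u + 1"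
proof -
  have u: "u \<in> X" "u' \<in> X" "u' \<noteq> u" "delta u u' = 1" "delta u' u = 1"
    using e E_sym[of u u'] delta_eq_0_iff[of u u] by (auto simp: E_iff)
  have M: "u \<inter> u' \<in> hyperplanes u" using E_hyperplane[OF e] .
  obtain g where g: "g \<in> X" "u \<inter> u' \<subseteq> g" "v \<inter> u \<subseteq> g" "delta v u = delta v g + delta g u"
    "delta v u' = delta v g + delta g u'"
    using gate[OF v hyperplane_singular[OF u(1) M]] u by (metis inf_le1 inf_le2)
  have "g = u \<or> g = u'" using opposite_unique[OF u(1) M g(1) _ g(2) u(2,3)] by blast
  thus ?thesis
  proof
    assume gu: "g = u"
    hence d: "delta v u' = delta v u + 1" using g(5) u(4) by simp
    have "\<not> u \<inter> v \<subseteq> u'"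
    proof
      assume "u \<inter> v \<subseteq> u'"
      hence "dim (v \<inter> u) \<le> dim (v \<inter> u')" by (intro dim_subset) auto
      thus False using d dim_Int_eq[OF v, of u] dim_Int_eq[OF v, of u'] by linarith
    qed
    thus ?thesis using d by blast
  next
    assume "g = u'"
    thus ?thesis using g(3,4) u(5) by auto
  qed
qed

lemma edge_nearer_iff:
  assumes "(u, u') \<in> E" "v \<in> X"
  shows "delta v u' + 1 = delta v u \<longleftrightarrow> u \<inter> v \<subseteq> u'"
  using edge_step[OF assms] by auto

lemma edge_parity:
  assumes "(u, u') \<in> E" "v \<in> X"
  shows "delta v u' + 1 = delta v u \<or> delta v u' = delta v u + 1"
  using edge_step[OF assms] by auto

lemma exists_nearer_neighbor:
  assumes u: "u \<in> X" and v: "v \<in> X" and "u \<noteq> v"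
  obtains u' where "(u, u') \<in> E" "delta v u = delta v u' + 1"
proof -
  have "u \<inter> v \<subset> u" using assms X_eqI by blast
  then obtain M where M: "M \<in> hyperplanes u" "u \<inter> v \<subseteq> M"
    using exists_hyperplane_over[of "u \<inter> v" u] X_D(3)[OF u] X_D(3)[OF v] subspace_inter by metis
  obtain u' where u': "u' \<in> X" "u' \<noteq> u" "M \<subseteq> u'" using exists_opposite[OF u M(1)] .
  have "(u, u') \<in> E" using E_hyperplaneI[OF u u'(1,2) M(1) u'(3)] by simp
  thus ?thesis using that edge_nearer_iff[OF _ v, of u u'] M(2) u'(3) by force
qed

lemma path_dist_eq:
  assumes u: "u \<in> X" and v: "v \<in> X"
  shows "path_dist E u v = delta u v"
  unfolding path_dist_def
proof (rule Least_equality)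
  show "(u, v) \<in> E ^^ delta u v"
    using v
  proof (induction "delta u v" arbitrary: v)
    case 0
    thus ?case using delta_eq_0_iff[OF u 0(2)] by simp
  next
    case (Suc n)
    have "v \<noteq> u" using Suc(2) delta_eq_0_iff[OF u u] by auto
    then obtain v' where v': "(v, v') \<in> E" "delta u v = delta u v' + 1"
      using exists_nearer_neighbor[OF Suc(3) u] by metis
    hence "(u, v') \<in> E ^^ n" using Suc by (auto simp: E_iff)
    moreover have "(v', v) \<in> E" using v'(1) E_sym by blast
    ultimately have "(u, v) \<in> E ^^ Suc n" by auto
    thus ?case using Suc(2) by simp
  qed
next
  fix n assume "(u, v) \<in> E ^^ n"
  thus "delta u v \<le> n"
    using v
  proof (induction n arbitrary: v)
    case 0
    thus ?case using delta_eq_0_iff[OF u u] by simp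
  next
    case (Suc n)
    then obtain w where w: "(u, w) \<in> E ^^ n" "(w, v) \<in> E" by auto
    hence "delta u w \<le> n" using Suc.IH by (simp add: E_iff)
    thus ?case using edge_step[OF w(2) u] by linarith
  qed
qed

section \<open>Counting neighbors\<close>

text \<open>The number of hyperplanes of a vertex that contain a given subspace of codimension \<open>k\<close>, read
  off from an arbitrary instance.\<close>

definition hyperplane_number :: "nat \<Rightarrow> nat" where
  "hyperplane_number k = (SOME n. \<exists>u S. u \<in> X \<and> subspace S \<and> S \<subseteq> u \<and> dim S + k = D \<and>
     n = card {M \<in> hyperplanes u. S \<subseteq> M})"

lemma card_hyperplanes_over:
  assumes "u \<in> X" "subspace S" "S \<subseteq> u" "dim S + k = D"
  shows "card {M \<in> hyperplanes u. S \<subseteq> M} = hyperplane_number k"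
proof -
  have "\<exists>u' S'. u' \<in> X \<and> subspace S' \<and> S' \<subseteq> u' \<and> dim S' + k = D \<and>
     hyperplane_number k = card {M \<in> hyperplanes u'. S' \<subseteq> M}"
    unfolding hyperplane_number_def by (rule someI_ex) (use assms in blast)
  then obtain u' S' where *: "u' \<in> X" "subspace S'" "S' \<subseteq> u'" "dim S' + k = D"
    "hyperplane_number k = card {M \<in> hyperplanes u'. S' \<subseteq> M}" by blast
  have "dim S = dim S'" using *(4) assms(4) by simp
  from card_hyperplanes_over_eq[OF assms(2) *(2) this] show ?thesis
    using X_D(2,3) * assms by simp
qed

lemma card_neighbors_over:
  assumes u: "u \<in> X" and S: "subspace S" "S \<subseteq> u" "dim S + k = D"
  shows "card {v. (u, v) \<in> E \<and> S \<subseteq> v} = hyperplane_number k"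
proof -
  have "bij_betw (\<lambda>v. u \<inter> v) {v. (u, v) \<in> E \<and> S \<subseteq> v} {M \<in> hyperplanes u. S \<subseteq> M}"
  proof (rule bij_betw_imageI)
    show "inj_on (\<lambda>v. u \<inter> v) {v. (u, v) \<in> E \<and> S \<subseteq> v}"
    proof (rule inj_onI)
      fix v w assume vw: "v \<in> {v. (u, v) \<in> E \<and> S \<subseteq> v}" "w \<in> {v. (u, v) \<in> E \<and> S \<subseteq> v}"
        and eq: "u \<inter> v = u \<inter> w"
      have "v \<in> X" "w \<in> X" "v \<noteq> u" "w \<noteq> u" "u \<inter> v \<in> hyperplanes u"
        using vw E_hyperplane delta_eq_0_iff[OF u u] by (auto simp: E_iff)
      thus "v = w" using opposite_unique[OF u, of "u \<inter> v" v w] eq by blast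
    qed
    show "(\<lambda>v. u \<inter> v) ` {v. (u, v) \<in> E \<and> S \<subseteq> v} = {M \<in> hyperplanes u. S \<subseteq> M}"
    proof (rule subset_antisym; rule subsetI)
      fix M assume "M \<in> (\<lambda>v. u \<inter> v) ` {v. (u, v) \<in> E \<and> S \<subseteq> v}"
      then obtain v where "(u, v) \<in> E" "S \<subseteq> v" "M = u \<inter> v" by blast
      thus "M \<in> {M \<in> hyperplanes u. S \<subseteq> M}" using S(2) E_hyperplane[of u v] by simp
    next
      fix M assume M: "M \<in> {M \<in> hyperplanes u. S \<subseteq> M}"
      then obtain v where v: "v \<in> X" "v \<noteq> u" "M \<subseteq> v" using exists_opposite[OF u, of M] by auto
      have "(u, v) \<in> E" "u \<inter> v = M" using E_hyperplaneI[OF u v(1,2) _ v(3)] M by auto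
      thus "M \<in> (\<lambda>v. u \<inter> v) ` {v. (u, v) \<in> E \<and> S \<subseteq> v}" using M v by auto
    qed
  qed
  hence "card {v. (u, v) \<in> E \<and> S \<subseteq> v} = card {M \<in> hyperplanes u. S \<subseteq> M}"
    by (rule bij_betw_same_card)
  thus ?thesis using card_hyperplanes_over[OF assms] by simp
qed

lemma finite_neighbors: "finite {v. (u, v) \<in> E \<and> Q v}"
  by (rule finite_subset[OF _ finite_X]) (auto simp: E_iff)

lemma card_neighbors:
  assumes u: "u \<in> X"
  shows "card {v. (u, v) \<in> E} = hyperplane_number D"
proof -
  have "{v. (u, v) \<in> E} = {v. (u, v) \<in> E \<and> {0} \<subseteq> v}"
    using X_D(3) subspace_0 by (auto simp: E_iff)
  thus ?thesis using card_neighbors_over[OF u, of "{0}" D] X_D(3)[OF u] subspace_0 by simp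
qed

lemma card_nearer:
  assumes u: "u \<in> X" and x: "x \<in> X"
  shows "card {v. (u, v) \<in> E \<and> delta x v + 1 = delta x u} = hyperplane_number (delta x u)"
proof -
  have "{v. (u, v) \<in> E \<and> delta x v + 1 = delta x u} = {v. (u, v) \<in> E \<and> u \<inter> x \<subseteq> v}"
    using edge_nearer_iff[OF _ x] by (intro Collect_cong conj_cong refl) simp
  thus ?thesis
    using card_neighbors_over[OF u, of "u \<inter> x" "delta x u"] X_D(3) u x dim_Int_eq[OF u, of x]
      delta_commute[of x u] by (simp add: subspace_inter)
qed

lemma card_nearer_both:
  assumes u: "u \<in> X" and x: "x \<in> X" and y: "y \<in> X"
    and k: "dim (u \<inter> x) + dim (u \<inter> y) + k = D + dim (u \<inter> x \<inter> y)"
  shows "card {v. (u, v) \<in> E \<and> delta x v + 1 = delta x u \<and> delta y v + 1 = delta y u}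
    = hyperplane_number k"
proof -
  have sub: "subspace (u \<inter> x)" "subspace (u \<inter> y)"
    using u x y X_D(3) by (simp_all add: subspace_inter)
  let ?S = "span (u \<inter> x \<union> u \<inter> y)"
  have "?S \<subseteq> v \<longleftrightarrow> u \<inter> x \<subseteq> v \<and> u \<inter> y \<subseteq> v" if "(u, v) \<in> E" for v
    using that span_superset[of "u \<inter> x \<union> u \<inter> y"] X_D(3)[of v] span_minimal[of "u \<inter> x \<union> u \<inter> y" v]
    by (auto simp: E_iff)
  hence "{v. (u, v) \<in> E \<and> delta x v + 1 = delta x u \<and> delta y v + 1 = delta y u} =
      {v. (u, v) \<in> E \<and> ?S \<subseteq> v}"
    using edge_nearer_iff[OF _ x] edge_nearer_iff[OF _ y]
    by (intro Collect_cong conj_cong refl) simp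
  moreover have "?S \<subseteq> u" using X_D(3)[OF u] by (intro span_minimal) auto
  moreover have "(u \<inter> x) \<inter> (u \<inter> y) = u \<inter> x \<inter> y" by auto
  ultimately show ?thesis
    using card_neighbors_over[OF u, of ?S k] dim_span_Un[OF sub] k by simp
qed

text \<open>For \<open>u\<close> in this set, \<open>y\<close> lies on a geodesic from \<open>x\<close> to \<open>u\<close>.\<close>

definition beyond :: "'v set \<Rightarrow> 'v set \<Rightarrow> nat \<Rightarrow> 'v set set" where
  "beyond x y i = {u \<in> X. delta y u = i \<and> delta x u = delta x y + i}"

definition near_count :: "'v set \<Rightarrow> 'v set \<Rightarrow> nat \<Rightarrow> 'v set \<Rightarrow> nat" where
  "near_count x y i u = card {v. (u, v) \<in> E \<and> delta x v + 1 = delta x u \<and> v \<in> beyond x y i}"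

definition far_count :: "'v set \<Rightarrow> 'v set \<Rightarrow> nat \<Rightarrow> 'v set \<Rightarrow> nat" where
  "far_count x y i u = card {v. (u, v) \<in> E \<and> delta x v = delta x u + 1 \<and> v \<in> beyond x y i}"

text \<open>A neighbor of \<open>u\<close> nearer to \<open>y\<close> is also nearer to \<open>x\<close> when \<open>y\<close> lies on a geodesic from \<open>x\<close>
  to \<open>u\<close>.\<close>

lemma near_count_eq:
  assumes u: "u \<in> X" and x: "x \<in> X" and y: "y \<in> X"
  shows "near_count x y i u = (if u \<in> beyond x y (Suc i) then hyperplane_number (Suc i) else 0)"
proof (cases "u \<in> beyond x y (Suc i)")
  case True
  hence d: "delta y u = Suc i" "delta x u = delta x y + Suc i" by (auto simp: beyond_def)
  have "{v. (u, v) \<in> E \<and> delta x v + 1 = delta x u \<and> v \<in> beyond x y i} =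
    {v. (u, v) \<in> E \<and> delta y v + 1 = delta y u}" (is "?A = ?B")
  proof (intro equalityI subsetI)
    fix v assume v: "v \<in> ?B"
    hence v': "(u, v) \<in> E" "v \<in> X" "delta y v = i" using d by (auto simp: E_iff)
    have "delta x v \<le> delta x y + i" using delta_triangle[OF x y v'(2)] v' by simp
    thus "v \<in> ?A" using edge_step[OF v'(1) x] v' d by (auto simp: beyond_def)
  qed (use d in \<open>auto simp: beyond_def\<close>)
  thus ?thesis using True card_nearer[OF u y] d by (simp add: near_count_def)
next
  case False
  have "\<not> (delta x v + 1 = delta x u \<and> v \<in> beyond x y i)" if e: "(u, v) \<in> E" for v
  proof
    assume v: "delta x v + 1 = delta x u \<and> v \<in> beyond x y i"
    have "delta x u \<le> delta x y + delta y u" using delta_triangle[OF x y u] .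
    hence "delta y u = Suc i" using edge_step[OF e y] v by (auto simp: beyond_def)
    thus False using False v u by (auto simp: beyond_def)
  qed
  hence "{v. (u, v) \<in> E \<and> delta x v + 1 = delta x u \<and> v \<in> beyond x y i} = {}" by blast
  thus ?thesis using False by (simp only: near_count_def card.empty if_False)
qed

text \<open>Dually to the previous count, a neighbor of \<open>u\<close> farther from \<open>x\<close> is here farther from \<open>y\<close>, so
  that all neighbors farther from \<open>x\<close> are counted.\<close>

lemma far_count_beyond:
  assumes u: "u \<in> X" and x: "x \<in> X" and y: "y \<in> X"
    and i: "delta x u + 1 = delta x y + i" "delta y u + 1 = i"
  shows "far_count x y i u + hyperplane_number (delta x u) = hyperplane_number D"
proof -
  have "{v. (u, v) \<in> E \<and> delta x v = delta x u + 1 \<and> v \<in> beyond x y i} =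
    {v. (u, v) \<in> E \<and> delta x v = delta x u + 1}" (is "?A = ?B")
  proof (intro equalityI subsetI)
    fix v assume v: "v \<in> ?B"
    hence v': "(u, v) \<in> E" "v \<in> X" by (auto simp: E_iff)
    have "delta x v \<le> delta x y + delta y v" using delta_triangle[OF x y v'(2)] .
    hence "delta y v = i" using edge_step[OF v'(1) y] v i by auto
    thus "v \<in> ?A" using v v' i by (auto simp: beyond_def)
  qed auto
  hence "far_count x y i u = card ?B" by (simp add: far_count_def)
  moreover have "card (?B \<union> {v. (u, v) \<in> E \<and> delta x v + 1 = delta x u}) =
    card ?B + card {v. (u, v) \<in> E \<and> delta x v + 1 = delta x u}"
    by (intro card_Un_disjoint finite_neighbors) auto
  moreover have "?B \<union> {v. (u, v) \<in> E \<and> delta x v + 1 = delta x u} = {v. (u, v) \<in> E}"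
    using edge_parity[OF _ x, of u] by blast
  ultimately show ?thesis using card_neighbors[OF u] card_nearer[OF u x] by simp
qed

text \<open>Here \<open>y\<close> is not on a geodesic from \<open>x\<close> to \<open>u\<close>, and the vertices counted are the neighbors
  nearer to \<open>y\<close> that are not nearer to \<open>x\<close>; the number \<open>k\<close> is the codimension in \<open>u\<close> of the sum
  of \<open>u \<inter> x\<close> and \<open>u \<inter> y\<close>.\<close>

lemma far_count_beside:
  assumes u: "u \<in> X" and x: "x \<in> X" and y: "y \<in> X"
    and i: "delta x u + 1 = delta x y + i" "delta y u = i + 1"
    and k: "dim (u \<inter> x) + dim (u \<inter> y) + k = D + dim (u \<inter> x \<inter> y)"
  shows "far_count x y i u + hyperplane_number k = hyperplane_number (i + 1)"
proof -
  let ?A = "{v. (u, v) \<in> E \<and> delta x v = delta x u + 1 \<and> v \<in> beyond x y i}"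
  let ?B = "{v. (u, v) \<in> E \<and> delta x v + 1 = delta x u \<and> delta y v + 1 = delta y u}"
  have "card (?A \<union> ?B) = card ?A + card ?B"
    by (intro card_Un_disjoint finite_neighbors) auto
  moreover have "delta x v = delta x u + 1 \<and> v \<in> beyond x y i \<or>
      delta x v + 1 = delta x u \<and> delta y v + 1 = delta y u \<longleftrightarrow> delta y v + 1 = delta y u"
    if "(u, v) \<in> E" for v
    using edge_parity[OF that x] that i by (auto simp: beyond_def E_iff)
  hence "?A \<union> ?B = {v. (u, v) \<in> E \<and> delta y v + 1 = delta y u}" by blast
  ultimately show ?thesis
    using card_nearer[OF u y] card_nearer_both[OF u x y k] i by (simp add: far_count_def)
qed

lemma far_count_eq_0:
  assumes u: "u \<in> X" and y: "y \<in> X"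
    and "delta y u + 1 \<noteq> i" "delta y u \<noteq> i + 1"
  shows "far_count x y i u = 0"
proof -
  have "{v. (u, v) \<in> E \<and> delta x v = delta x u + 1 \<and> v \<in> beyond x y i} = {}"
    using edge_step[OF _ y, of u] assms(3,4) by (fastforce simp: beyond_def)
  thus ?thesis by (simp only: far_count_def card.empty)
qed


section \<open>Pairs of vertices with the same lowering coefficients\<close>

text \<open>In terms of matrices, the lowering matrix sends the difference of the indicator vectors of
  \<open>beyond x y i\<close> and \<open>beyond x z i\<close> to a multiple of the difference for \<open>i - 1\<close>. It is essential that
  the factor is a function of \<open>i\<close> in which the distance of \<open>y\<close> and \<open>z\<close> from \<open>x\<close> does not occur.\<close>

definition balanced :: "'v set \<Rightarrow> 'v set \<Rightarrow> 'v set \<Rightarrow> bool" where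
  "balanced x y z \<longleftrightarrow> delta x y = delta x z \<and> (\<forall>i. \<forall>u\<in>X. delta x u + 1 = delta x y + i \<longrightarrow>
     int (far_count x y i u) - int (far_count x z i u) =
     (int (hyperplane_number D) - int (hyperplane_number (i + 1))) *
     (of_bool (delta y u + 1 = i) - of_bool (delta z u + 1 = i)))"

text \<open>The term in front of the indicator of \<open>delta y u + 1 = i\<close> is what matters: the rest does not
  involve \<open>y\<close> and cancels between two neighbors of \<open>x\<close>.\<close>

lemma far_count_adjacent:
  assumes xy: "(x, y) \<in> E" and u: "u \<in> X" and i: "delta x u = i"
  shows "int (far_count x y i u) = int (hyperplane_number (i + 1)) - int (hyperplane_number i) +
    (int (hyperplane_number D) - int (hyperplane_number (i + 1))) * of_bool (delta y u + 1 = i)"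
proof -
  have x: "x \<in> X" and y: "y \<in> X" and d: "delta x y = 1" using xy by (auto simp: E_iff)
  have i': "delta x u + 1 = delta x y + i" using i d by simp
  show ?thesis
  proof (cases "delta y u + 1 = i")
    case True
    thus ?thesis using far_count_beyond[OF u x y i'] i by simp
  next
    case False
    hence f: "\<not> x \<inter> u \<subseteq> y" "delta y u = i + 1"
      using edge_step[OF xy u] i by (auto simp: delta_commute[of u])
    have "(y, x) \<in> E" using xy E_sym by blast
    hence "y \<inter> u \<subseteq> x" using edge_step[of y x u] u f i by (auto simp: delta_commute[of u])
    hence "u \<inter> x \<inter> y = u \<inter> y" by auto
    hence "dim (u \<inter> x) + dim (u \<inter> y) + i = D + dim (u \<inter> x \<inter> y)"
      using dim_Int_eq[OF u, of x] i by (simp add: delta_commute[of u])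
    from far_count_beside[OF u x y i' f(2) this] show ?thesis using False by simp
  qed
qed

lemma balanced_adjacent:
  assumes "(x, y) \<in> E" "(x, z) \<in> E"
  shows "balanced x y z"
proof -
  have d: "delta x y = 1" "delta x z = 1" using assms by (auto simp: E_iff)
  have "int (far_count x y i u) - int (far_count x z i u) =
     (int (hyperplane_number D) - int (hyperplane_number (i + 1))) *
     (of_bool (delta y u + 1 = i) - of_bool (delta z u + 1 = i))"
    if "u \<in> X" "delta x u = i" for u i
    using far_count_adjacent[OF assms(1) that] far_count_adjacent[OF assms(2) that]
    unfolding right_diff_distrib by linarith
  thus ?thesis using d by (simp add: balanced_def)
qed

lemma exists_two_neighbors:
  assumes x: "x \<in> X"
  obtains y z where "(x, y) \<in> E" "(x, z) \<in> E" "y \<noteq> z"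
proof -
  have dx: "dim x \<ge> 2" using x X_D(2) D_ge_2 by simp
  obtain H where H: "H \<in> hyperplanes x" using exists_hyperplane[OF X_D(3)[OF x]] dx by auto
  obtain K where K: "K \<in> hyperplanes x" "K \<noteq> H"
    using three_hyperplanes[OF X_D(3)[OF x] H dx] by metis
  obtain y where y: "y \<in> X" "y \<noteq> x" "H \<subseteq> y" using exists_opposite[OF x H] .
  obtain z where z: "z \<in> X" "z \<noteq> x" "K \<subseteq> z" using exists_opposite[OF x K(1)] .
  show ?thesis
    using that E_hyperplaneI[OF x y(1,2) H y(3)] E_hyperplaneI[OF x z(1,2) K(1) z(3)] K(2) by metis
qed

text \<open>The case in which the gate of \<open>u\<close> over \<open>P\<close> is \<open>y\<close>: then \<open>y\<close> lies on geodesics from \<open>u\<close> to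
  \<open>x\<close> and to \<open>z\<close>, which forces \<open>u \<inter> x\<close> and \<open>u \<inter> z\<close> to coincide. So a neighbor of \<open>u\<close> that is nearer
  to \<open>z\<close> is also nearer to \<open>x\<close>.\<close>

lemma balanced_at_gate:
  assumes x: "x \<in> X" and y: "y \<in> X" and z: "z \<in> X" and u: "u \<in> X"
    and P: "x \<inter> y = P" "x \<inter> z = P" "y \<inter> z = P" "dim P + 2 = D"
    and gate: "u \<inter> x \<subseteq> y" "u \<inter> z \<subseteq> y" "\<And>v. v \<in> X \<Longrightarrow> P \<subseteq> v \<Longrightarrow> delta u v = delta u y + delta y v"
    and i: "delta x u = i + 1"
  shows "far_count x y i u + hyperplane_number (i + 1) = hyperplane_number D"
    and "far_count x z i u = 0" and "delta y u + 1 = i" and "delta z u = i + 1"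
proof -
  have d: "delta x y = 2" "delta x z = 2" "delta y z = 2"
    using P dim_Int_eq[OF x, of y] dim_Int_eq[OF x, of z] dim_Int_eq[OF y, of z] by auto
  have "delta u x = delta u y + 2" "delta u z = delta u y + 2"
    using gate(3)[OF x] gate(3)[OF z] P d delta_commute[of y x] by auto
  thus y1: "delta y u + 1 = i" and z1: "delta z u = i + 1"
    using i delta_commute[of u] by auto
  show "far_count x y i u + hyperplane_number (i + 1) = hyperplane_number D"
    using far_count_beyond[OF u x y _ y1] i d by simp
  have "u \<inter> x = u \<inter> P" "u \<inter> z = u \<inter> P" "u \<inter> x \<inter> z = u \<inter> P" using gate P by auto
  hence "dim (u \<inter> x) + dim (u \<inter> z) + (i + 1) = D + dim (u \<inter> x \<inter> z)"
    using dim_Int_eq[OF u, of x] i by (simp add: delta_commute[of u])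
  from far_count_beside[OF u x z _ z1 this] show "far_count x z i u = 0" using i d by simp
qed

text \<open>The vertices through \<open>P\<close> form a complete bipartite graph in which \<open>x\<close>, \<open>y\<close>, \<open>z\<close> have the same
  color. If the gate of \<open>u\<close> is neither \<open>y\<close> nor \<open>z\<close>, it is equidistant from them, all intersections that
  enter the counts have the same dimensions for \<open>y\<close> and for \<open>z\<close>, and the difference is zero.\<close>

lemma balanced_codim_2:
  assumes x: "x \<in> X" and y: "y \<in> X" and z: "z \<in> X"
    and P: "x \<inter> y = P" "x \<inter> z = P" "y \<inter> z = P" "dim P + 2 = D"
  shows "balanced x y z"
proof -
  have d: "delta x y = 2" "delta x z = 2" "delta y z = 2"
    using P dim_Int_eq[OF x, of y] dim_Int_eq[OF x, of z] dim_Int_eq[OF y, of z] by auto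
  have "subspace P" using P(1) x y X_D(3) subspace_inter by blast
  hence sP: "singular P" using singular_sub[OF X_D(1)[OF x]] P(1) by blast
  have sub: "P \<subseteq> x" "P \<subseteq> y" "P \<subseteq> z" using P by auto
  have "int (far_count x y i u) - int (far_count x z i u) =
     (int (hyperplane_number D) - int (hyperplane_number (i + 1))) *
     (of_bool (delta y u + 1 = i) - of_bool (delta z u + 1 = i))"
    if u: "u \<in> X" and i: "delta x u = i + 1" for u i
  proof -
    obtain g where g: "g \<in> X" "P \<subseteq> g"
      and cut: "\<And>v. v \<in> X \<Longrightarrow> P \<subseteq> v \<Longrightarrow> u \<inter> v \<subseteq> g"
      and dist: "\<And>v. v \<in> X \<Longrightarrow> P \<subseteq> v \<Longrightarrow> delta u v = delta u g + delta g v"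
      using gate[OF u sP] by metis
    consider "g = y" | "g = z" | "g \<noteq> y" "g \<noteq> z" by blast
    thus ?thesis
    proof cases
      case 1
      have "far_count x y i u + hyperplane_number (i + 1) = hyperplane_number D"
        "far_count x z i u = 0" "delta y u + 1 = i" "delta z u = i + 1"
        by (rule balanced_at_gate[OF x y z u P _ _ _ i];
            use cut[OF x] cut[OF z] dist sub 1 in simp)+
      thus ?thesis by simp
    next
      case 2
      have P': "z \<inter> y = P" using P(3) by auto
      have "far_count x z i u + hyperplane_number (i + 1) = hyperplane_number D"
        "far_count x y i u = 0" "delta z u + 1 = i" "delta y u = i + 1"
        by (rule balanced_at_gate[OF x z y u P(2,1) P' P(4) _ _ _ i];
            use cut[OF x] cut[OF y] dist sub 2 in simp)+
      thus ?thesis by simp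
    next
      case 3
      have le2: "delta g v \<le> 2" if "v \<in> X" "P \<subseteq> v" for v
        using that g dim_subset[of P "g \<inter> v"] dim_Int_eq[OF g(1), of v] P(4) by auto
      have one: "delta g b = 1"
        if "delta g a = 1" "a \<in> X" "b \<in> X" "P \<subseteq> b" "delta a b = 2" for a b
      proof -
        have "(a, g) \<in> E" using that g by (simp add: E_iff delta_commute)
        from edge_parity[OF this that(3)] show ?thesis
          using that le2[OF that(3,4)] by (auto simp: delta_commute[of b])
      qed
      have pos: "delta g y \<noteq> 0" "delta g z \<noteq> 0" using 3 delta_eq_0_iff g y z by auto
      have eq: "delta g y = delta g z"
        using one[OF _ y z sub(3) d(3)] one[OF _ z y sub(2)] d(3) pos le2[OF y sub(2)]
          le2[OF z sub(3)] delta_commute[of y z] by linarith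
      have eq': "delta y u = delta z u"
        using dist[OF y sub(2)] dist[OF z sub(3)] eq by (simp add: delta_commute)
      have ne: "delta y u + 1 \<noteq> i"
        using dist[OF y sub(2)] dist[OF x sub(1)] le2[OF x sub(1)] pos(1) i
        by (simp add: delta_commute)
      have "far_count x y i u = far_count x z i u"
      proof (cases "delta y u = i + 1")
        case True
        have t: "u \<inter> x \<inter> y = u \<inter> P" "u \<inter> x \<inter> z = u \<inter> P" using P by auto
        have same: "dim (u \<inter> y) = dim (u \<inter> z)"
          using eq' dim_Int_eq[OF u, of y] dim_Int_eq[OF u, of z] by (simp add: delta_commute[of u])
        have "dim (u \<inter> x) + dim (u \<inter> y) \<le> dim (u \<inter> x \<inter> y) + D"
        proof -
          have "subspace (u \<inter> x)" "subspace (u \<inter> y)" using u x y X_D(3) by (simp_all add: subspace_inter)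
          from dim_Int_ge[OF this X_D(3)[OF u]] show ?thesis
            using X_D(2)[OF u] by (simp add: Int_assoc Int_left_commute)
        qed
        then obtain k where k: "dim (u \<inter> x) + dim (u \<inter> y) + k = D + dim (u \<inter> x \<inter> y)"
          using le_Suc_ex by (metis add.commute)
        have k': "dim (u \<inter> x) + dim (u \<inter> z) + k = D + dim (u \<inter> x \<inter> z)" using k same t by simp
        have "far_count x y i u + hyperplane_number k = hyperplane_number (i + 1)"
          using far_count_beside[OF u x y _ True k] i d by simp
        moreover have "far_count x z i u + hyperplane_number k = hyperplane_number (i + 1)"
          using far_count_beside[OF u x z _ _ k'] i d True eq' by simp
        ultimately show ?thesis by simp
      next
        case False
        thus ?thesis using far_count_eq_0[OF u y ne] far_count_eq_0[OF u z] ne eq' by simp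
      qed
      thus ?thesis using ne eq' by simp
    qed
  qed
  thus ?thesis using d by (simp add: balanced_def)
qed

text \<open>The vertices \<open>x\<close>, \<open>y\<close>, \<open>z\<close> are the neighbors of one vertex \<open>a\<close> over three hyperplanes of
  \<open>a\<close> that share a subspace of codimension 2.\<close>

lemma exists_balanced_codim_2:
  assumes x: "x \<in> X"
  obtains y z where "y \<in> X" "z \<in> X" "y \<noteq> z" "delta x y = 2" "delta x z = 2" "balanced x y z"
proof -
  have opp: "v \<inter> w = P"
    if a: "a \<in> X" and P: "P \<subseteq> K" "P \<subseteq> L" "subspace P" "dim P + 2 = D" "K \<noteq> L"
      and v: "v \<in> X" "(a, v) \<in> E" "a \<inter> v = K" and w: "w \<in> X" "(a, w) \<in> E" "a \<inter> w = L"
    for a v w K L P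
  proof -
    have "v \<noteq> w" using v w P by auto
    moreover have "delta v a = 1" using v by (simp add: E_iff delta_commute)
    ultimately have "delta v w = 2"
      using edge_parity[OF w(2) v(1)] delta_eq_0_iff[OF v(1) w(1)] by auto
    hence "dim (v \<inter> w) + 2 = D" using dim_Int_eq[OF v(1), of w] by simp
    moreover have "P \<subseteq> v \<inter> w" using P v w by auto
    moreover have "subspace (v \<inter> w)" using v w X_D(3) by (simp add: subspace_inter)
    ultimately have "P = v \<inter> w" using P(3,4) by (intro subspace_dim_equal) auto
    thus ?thesis by simp
  qed
  have "dim x > 0" using X_D(2)[OF x] D_ge_2 by simp
  then obtain H where Hx: "H \<in> hyperplanes x" using exists_hyperplane[OF X_D(3)[OF x]] by blast
  obtain a where a: "a \<in> X" "a \<noteq> x" "H \<subseteq> a" using exists_opposite[OF x Hx] .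
  have ax: "(a, x) \<in> E" "a \<inter> x = H"
    using E_hyperplaneI[OF x a(1,2) Hx a(3)] E_sym[of a x] by auto
  have H: "H \<in> hyperplanes a" using E_hyperplane[OF ax(1)] ax(2) by simp
  have "dim a \<ge> 2" using X_D(2)[OF a(1)] D_ge_2 by simp
  from three_hyperplanes[OF X_D(3)[OF a(1)] H this]
  obtain P K L where P: "P \<in> hyperplanes H" "P \<subseteq> K" "P \<subseteq> L"
    and KL: "K \<in> hyperplanes a" "L \<in> hyperplanes a" "K \<noteq> H" "L \<noteq> H" "K \<noteq> L" .
  have P': "subspace P" "P \<subseteq> H" "dim P + 2 = D"
    using P(1) H X_D(2)[OF a(1)] by (auto simp: hyperplanes_def)
  obtain y where y: "y \<in> X" "y \<noteq> a" "K \<subseteq> y" using exists_opposite[OF a(1) KL(1)] .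
  obtain z where z: "z \<in> X" "z \<noteq> a" "L \<subseteq> z" using exists_opposite[OF a(1) KL(2)] .
  note ey = E_hyperplaneI[OF a(1) y(1,2) KL(1) y(3)]
  note ez = E_hyperplaneI[OF a(1) z(1,2) KL(2) z(3)]
  have xy: "x \<inter> y = P" using opp[OF a(1) P'(2) P(2) P'(1,3) KL(3)[symmetric] x ax y(1) ey] .
  have xz: "x \<inter> z = P" using opp[OF a(1) P'(2) P(3) P'(1,3) KL(4)[symmetric] x ax z(1) ez] .
  have yz: "y \<inter> z = P" using opp[OF a(1) P(2) P(3) P'(1,3) KL(5) y(1) ey z(1) ez] .
  have "y \<noteq> z" using ey(2) ez(2) KL(5) by auto
  moreover have "delta x y = 2" "delta x z = 2"
    using xy xz P'(3) dim_Int_eq[OF x, of y] dim_Int_eq[OF x, of z] by auto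
  ultimately show ?thesis
    using that[OF y(1) z(1)] balanced_codim_2[OF x y(1) z(1) xy xz yz P'(3)] by blast
qed

end

section \<open>Matrices acting in the same way on two families of vectors\<close>

definition mat_vec :: "'x set \<Rightarrow> 'x cmatrix \<Rightarrow> ('x \<Rightarrow> complex) \<Rightarrow> 'x \<Rightarrow> complex" where
  "mat_vec X M g = (\<lambda>u. \<Sum>w\<in>X. M u w * g w)"

lemma mat_vec_combination:
  "mat_vec X M (\<lambda>u. g u + c * h u) = (\<lambda>u. mat_vec X M g u + c * mat_vec X M h u)"
  by (simp add: mat_vec_def ring_distribs sum.distrib sum_distrib_left mult_ac)

lemma mat_vec_zero: "mat_vec X M (\<lambda>u. 0) = (\<lambda>u. 0)"
  by (simp add: mat_vec_def)

lemma mat_vec_add: "mat_vec X (mat_add M N) g = (\<lambda>u. mat_vec X M g u + mat_vec X N g u)"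
  by (simp add: mat_vec_def mat_add_def ring_distribs sum.distrib)

lemma mat_vec_smult: "mat_vec X (mat_smult c M) g = (\<lambda>u. c * mat_vec X M g u)"
  by (simp add: mat_vec_def mat_smult_def sum_distrib_left mult_ac)

lemma mat_vec_mult: "mat_vec X (mat_mult X M N) g = mat_vec X M (mat_vec X N g)"
proof
  fix u
  have "(\<Sum>w\<in>X. (\<Sum>v\<in>X. M u v * N v w) * g w) = (\<Sum>v\<in>X. \<Sum>w\<in>X. M u v * N v w * g w)"
    by (simp add: sum_distrib_right) (rule sum.swap)
  thus "mat_vec X (mat_mult X M N) g u = mat_vec X M (mat_vec X N g) u"
    by (simp add: mat_vec_def mat_mult_def sum_distrib_left mult.assoc)
qed

lemma mat_vec_one:
  assumes "finite X" "\<And>u. u \<notin> X \<Longrightarrow> g u = 0"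
  shows "mat_vec X (mat_one X) g = g"
proof
  fix u
  have "(\<Sum>w\<in>X. mat_one X u w * g w) = (\<Sum>w\<in>X. if u = w then g w else 0)"
    by (intro sum.cong) (auto simp: mat_one_def)
  thus "mat_vec X (mat_one X) g u = g u" using assms by (simp add: mat_vec_def)
qed

text \<open>The span of the pairs \<open>(e i, f i)\<close>. A matrix acting in the same way on the families \<open>e\<close> and \<open>f\<close>
  preserves it, so that it can replace an isomorphism between the modules that they span. The
  inductive form lets linear statements be checked on one generator at a time.\<close>

inductive_set pair_span ::
    "('i \<Rightarrow> 'x \<Rightarrow> complex) \<Rightarrow> ('i \<Rightarrow> 'x \<Rightarrow> complex) \<Rightarrow> (('x \<Rightarrow> complex) \<times> ('x \<Rightarrow> complex)) set"
  for e f where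
  zero: "(\<lambda>u. 0, \<lambda>u. 0) \<in> pair_span e f"
| step: "(g, h) \<in> pair_span e f \<Longrightarrow> (\<lambda>u. g u + c * e i u, \<lambda>u. h u + c * f i u) \<in> pair_span e f"

lemma pair_span_generator: "(e i, f i) \<in> pair_span e f"
  using pair_span.step[OF pair_span.zero, of 1 e i f] by simp

lemma pair_span_combination:
  assumes "(g, h) \<in> pair_span e f" "(g', h') \<in> pair_span e f"
  shows "(\<lambda>u. g u + c * g' u, \<lambda>u. h u + c * h' u) \<in> pair_span e f"
  using assms(2)
proof induction
  case zero
  thus ?case using assms(1) by simp
next
  case (step g' h' d i)
  from pair_span.step[OF step.IH, of "c * d" i] show ?case by (simp add: algebra_simps)
qed

definition joint_stabilizer ::
    "'x set \<Rightarrow> ('i \<Rightarrow> 'x \<Rightarrow> complex) \<Rightarrow> ('i \<Rightarrow> 'x \<Rightarrow> complex) \<Rightarrow> 'x cmatrix set" where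
  "joint_stabilizer X e f =
     {M \<in> Mat X. \<forall>(g, h)\<in>pair_span e f. (mat_vec X M g, mat_vec X M h) \<in> pair_span e f}"

lemma mat_subalgebra_joint_stabilizer:
  assumes "finite X" and supp: "\<And>i u. u \<notin> X \<Longrightarrow> e i u = 0 \<and> f i u = 0"
  shows "mat_subalgebra X (joint_stabilizer X e f)"
proof -
  let ?S = "joint_stabilizer X e f"
  have "g u = 0 \<and> h u = 0" if "(g, h) \<in> pair_span e f" "u \<notin> X" for g h u
    using that supp by (induction rule: pair_span.induct) auto
  hence "(mat_vec X (mat_one X) g, mat_vec X (mat_one X) h) \<in> pair_span e f"
    if "(g, h) \<in> pair_span e f" for g h
    using that by (simp add: mat_vec_one[OF assms(1)])
  hence "mat_one X \<in> ?S" by (auto simp: joint_stabilizer_def Mat_def mat_one_def)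
  moreover have "mat_add M N \<in> ?S" if "M \<in> ?S" "N \<in> ?S" for M N
  proof -
    have "(mat_vec X (mat_add M N) g, mat_vec X (mat_add M N) h) \<in> pair_span e f"
      if gh: "(g, h) \<in> pair_span e f" for g h
    proof -
      have "(mat_vec X M g, mat_vec X M h) \<in> pair_span e f"
        "(mat_vec X N g, mat_vec X N h) \<in> pair_span e f"
        using \<open>M \<in> ?S\<close> \<open>N \<in> ?S\<close> gh by (auto simp: joint_stabilizer_def)
      from pair_span_combination[OF this, of 1] show ?thesis by (simp add: mat_vec_add)
    qed
    thus ?thesis using that by (auto simp: joint_stabilizer_def Mat_def mat_add_def)
  qed
  moreover have "mat_smult c M \<in> ?S" if "M \<in> ?S" for c M
  proof -
    have "(mat_vec X (mat_smult c M) g, mat_vec X (mat_smult c M) h) \<in> pair_span e f"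
      if gh: "(g, h) \<in> pair_span e f" for g h
    proof -
      have "(mat_vec X M g, mat_vec X M h) \<in> pair_span e f"
        using \<open>M \<in> ?S\<close> gh by (auto simp: joint_stabilizer_def)
      from pair_span_combination[OF pair_span.zero this, of c] show ?thesis
        by (simp add: mat_vec_smult)
    qed
    thus ?thesis using that by (auto simp: joint_stabilizer_def Mat_def mat_smult_def)
  qed
  moreover have "mat_mult X M N \<in> ?S" if "M \<in> ?S" "N \<in> ?S" for M N
  proof -
    have "mat_mult X M N \<in> Mat X" using that by (auto simp: joint_stabilizer_def Mat_def mat_mult_def)
    thus ?thesis using that by (auto simp: joint_stabilizer_def mat_vec_mult)
  qed
  ultimately show ?thesis by (auto simp: mat_subalgebra_def joint_stabilizer_def)
qed

lemma joint_stabilizerI: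
  assumes "M \<in> Mat X"
    and act: "\<And>i. \<exists>c k. mat_vec X M (e i) = (\<lambda>u. c * e k u) \<and> mat_vec X M (f i) = (\<lambda>u. c * f k u)"
  shows "M \<in> joint_stabilizer X e f"
proof -
  have "(mat_vec X M g, mat_vec X M h) \<in> pair_span e f" if "(g, h) \<in> pair_span e f" for g h
    using that
  proof induction
    case zero
    thus ?case by (simp add: mat_vec_zero pair_span.zero)
  next
    case (step g h d i)
    obtain c k where "mat_vec X M (e i) = (\<lambda>u. c * e k u)" "mat_vec X M (f i) = (\<lambda>u. c * f k u)"
      using act by blast
    with pair_span.step[OF step.IH, of "d * c" k] show ?case
      by (simp add: mat_vec_combination mult.assoc)
  qed
  thus ?thesis using assms(1) by (auto simp: joint_stabilizer_def)
qed

lemma adjacency_block_eq: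
  assumes "finite X"
  shows "adjacency_block X E x i j u v =
    of_bool (u \<in> X \<and> v \<in> X \<and> (u, v) \<in> E \<and> path_dist E x u = i \<and> path_dist E x v = j)"
proof -
  have 1: "mat_mult X (dual_idempotent X E x i) (adjacency_matrix E) u w =
      of_bool (u \<in> X \<and> (u, w) \<in> E \<and> path_dist E x u = i)" for w
  proof -
    have "(\<Sum>s\<in>X. dual_idempotent X E x i u s * adjacency_matrix E s w) =
      (\<Sum>s\<in>X. if u = s then of_bool ((u, w) \<in> E \<and> path_dist E x u = i) else 0)"
      by (intro sum.cong) (auto simp: dual_idempotent_def adjacency_matrix_def)
    thus ?thesis using assms by (simp add: mat_mult_def)
  qed
  have "adjacency_block X E x i j u v =
    (\<Sum>w\<in>X. if v = w then of_bool (u \<in> X \<and> (u, v) \<in> E \<and> path_dist E x u = i \<and> path_dist E x v = j)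
      else 0)"
    unfolding adjacency_block_def mat_mult_def[of X _ "dual_idempotent X E x j"] 1
    by (intro sum.cong) (auto simp: dual_idempotent_def)
  thus ?thesis using assms by simp
qed

lemma dual_idempotent_mat_vec:
  assumes "finite X" "u \<in> X"
  shows "mat_vec X (dual_idempotent X E x i) g u = (if path_dist E x u = i then g u else 0)"
proof -
  have "mat_vec X (dual_idempotent X E x i) g u =
    (\<Sum>w\<in>X. if u = w then (if path_dist E x u = i then g u else 0) else 0)"
    unfolding mat_vec_def by (intro sum.cong) (auto simp: dual_idempotent_def assms(2))
  thus ?thesis using assms by simp
qed

section \<open>The quantum adjacency algebra of the dual polar graph\<close>

context hyperbolic_space
begin

lemma delta_le_eccentricity:
  assumes "x \<in> X" "u \<in> X"
  shows "delta x u \<le> eccentricity X E x"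
  using finite_X assms by (auto simp: eccentricity_def path_dist_eq[OF assms, symmetric] intro: Max_ge)

lemma lowering_matrix_eq:
  assumes x: "x \<in> X"
  shows "lowering_matrix X E x u v = of_bool ((u, v) \<in> E \<and> delta x v = delta x u + 1)"
proof -
  have "lowering_matrix X E x u v = (\<Sum>i = 1..eccentricity X E x.
      if i = delta x v then of_bool ((u, v) \<in> E \<and> delta x v = delta x u + 1) else 0)"
    unfolding lowering_matrix_def
    by (intro sum.cong) (auto simp: adjacency_block_eq[OF finite_X] E_iff path_dist_eq[OF x])
  thus ?thesis using delta_le_eccentricity[OF x, of v] by (auto simp: E_iff)
qed

lemma raising_matrix_eq:
  assumes x: "x \<in> X"
  shows "raising_matrix X E x u v = of_bool ((u, v) \<in> E \<and> delta x v + 1 = delta x u)"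
proof -
  have "raising_matrix X E x u v = (\<Sum>i = 0..<eccentricity X E x.
      if i = delta x v then of_bool ((u, v) \<in> E \<and> delta x v + 1 = delta x u) else 0)"
    unfolding raising_matrix_def
    by (intro sum.cong) (auto simp: adjacency_block_eq[OF finite_X] E_iff path_dist_eq[OF x])
  thus ?thesis using delta_le_eccentricity[OF x, of u] by (auto simp: E_iff)
qed

lemma flat_matrix_eq:
  assumes x: "x \<in> X"
  shows "flat_matrix X E x u v = 0"
proof -
  have "adjacency_block X E x i i u v = 0" for i
    using edge_parity[of u v x] x
    by (auto simp: adjacency_block_eq[OF finite_X] path_dist_eq[OF x])
  thus ?thesis by (simp add: flat_matrix_def)
qed

text \<open>For \<open>balanced x y z\<close> with \<open>y \<noteq> z\<close> these vectors span a \<open>T\<close>-module whose lowest vector,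
  the difference of the unit vectors at \<open>y\<close> and \<open>z\<close>, lies in the subconstituent \<open>delta x y\<close>.\<close>

definition beyond_difference :: "'v set \<Rightarrow> 'v set \<Rightarrow> 'v set \<Rightarrow> nat \<Rightarrow> 'v set \<Rightarrow> complex" where
  "beyond_difference x y z i u = of_bool (u \<in> beyond x y i) - of_bool (u \<in> beyond x z i)"

lemma sum_of_bool_beyond:
  assumes "\<And>v. Q v \<Longrightarrow> v \<in> X"
  shows "(\<Sum>v\<in>X. of_bool (Q v) * beyond_difference x y z i v) =
    of_nat (card {v. Q v \<and> v \<in> beyond x y i}) - of_nat (card {v. Q v \<and> v \<in> beyond x z i})"
proof -
  have "(\<Sum>v\<in>X. of_bool (Q v) * of_bool (v \<in> beyond x w i)) =
      (of_nat (card {v. Q v \<and> v \<in> beyond x w i}) :: complex)" for w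
  proof -
    have "(\<Sum>v\<in>X. of_bool (Q v) * of_bool (v \<in> beyond x w i)) =
        (\<Sum>v\<in>X. of_bool (Q v \<and> v \<in> beyond x w i) :: complex)"
      by (intro sum.cong) auto
    also have "\<dots> = of_nat (card (X \<inter> {v. Q v \<and> v \<in> beyond x w i}))"
      using finite_X by simp
    also have "X \<inter> {v. Q v \<and> v \<in> beyond x w i} = {v. Q v \<and> v \<in> beyond x w i}"
      using assms by auto
    finally show ?thesis .
  qed
  thus ?thesis by (simp add: beyond_difference_def right_diff_distrib sum_subtractf)
qed

lemma raise_beyond_difference:
  assumes x: "x \<in> X" and y: "y \<in> X" and z: "z \<in> X"
  shows "mat_vec X (raising_matrix X E x) (beyond_difference x y z i) =
    (\<lambda>u. of_nat (hyperplane_number (Suc i)) * beyond_difference x y z (Suc i) u)"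
proof
  fix u
  have "mat_vec X (raising_matrix X E x) (beyond_difference x y z i) u =
      of_nat (near_count x y i u) - of_nat (near_count x z i u)"
    unfolding mat_vec_def raising_matrix_eq[OF x]
    by (subst sum_of_bool_beyond) (auto simp: E_iff near_count_def)
  also have "\<dots> = of_nat (hyperplane_number (Suc i)) * beyond_difference x y z (Suc i) u"
  proof (cases "u \<in> X")
    case True
    thus ?thesis using near_count_eq x y z by (simp add: beyond_difference_def)
  next
    case False
    thus ?thesis by (simp add: near_count_def E_iff beyond_difference_def beyond_def)
  qed
  finally show "mat_vec X (raising_matrix X E x) (beyond_difference x y z i) u =
      of_nat (hyperplane_number (Suc i)) * beyond_difference x y z (Suc i) u" .
qed

lemma lower_beyond_difference:
  assumes x: "x \<in> X" and bal: "balanced x y z"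
  shows "mat_vec X (lowering_matrix X E x) (beyond_difference x y z i) =
    (\<lambda>u. (if i = 0 then 0 else of_nat (hyperplane_number D) - of_nat (hyperplane_number (i + 1))) *
      beyond_difference x y z (i - 1) u)"
proof
  fix u
  have d: "delta x y = delta x z" using bal by (simp add: balanced_def)
  have *: "mat_vec X (lowering_matrix X E x) (beyond_difference x y z i) u =
      of_nat (far_count x y i u) - of_nat (far_count x z i u)"
    unfolding mat_vec_def lowering_matrix_eq[OF x]
    by (subst sum_of_bool_beyond) (auto simp: E_iff far_count_def)
  show "mat_vec X (lowering_matrix X E x) (beyond_difference x y z i) u =
    (if i = 0 then 0 else of_nat (hyperplane_number D) - of_nat (hyperplane_number (i + 1))) *
      beyond_difference x y z (i - 1) u"
  proof (cases "u \<in> X \<and> delta x u + 1 = delta x y + i")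
    case True
    hence "int (far_count x y i u) - int (far_count x z i u) =
     (int (hyperplane_number D) - int (hyperplane_number (i + 1))) *
     (of_bool (delta y u + 1 = i) - of_bool (delta z u + 1 = i))"
      using bal by (simp add: balanced_def)
    hence "of_int (int (far_count x y i u) - int (far_count x z i u)) =
     (of_int ((int (hyperplane_number D) - int (hyperplane_number (i + 1))) *
     (of_bool (delta y u + 1 = i) - of_bool (delta z u + 1 = i))) :: complex)" by simp
    hence "of_nat (far_count x y i u) - of_nat (far_count x z i u) =
     ((of_nat (hyperplane_number D) - of_nat (hyperplane_number (i + 1))) *
     (of_bool (delta y u + 1 = i) - of_bool (delta z u + 1 = i)) :: complex)"
      by (simp only: of_int_diff of_int_mult of_int_of_nat_eq of_int_of_bool)
    thus ?thesis using True d unfolding *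
      by (cases i) (auto simp: beyond_difference_def beyond_def)
  next
    case False
    have "{v. (u, v) \<in> E \<and> delta x v = delta x u + 1 \<and> v \<in> beyond x w i} = {}"
      if "delta x w = delta x y" for w
      using False that by (auto simp: E_iff beyond_def)
    hence "far_count x y i u = 0" "far_count x z i u = 0"
      using d by (simp_all only: far_count_def card.empty)
    thus ?thesis using False d unfolding *
      by (cases i) (auto simp: beyond_difference_def beyond_def)
  qed
qed

lemma beyond_difference_at:
  assumes "y \<in> X" "z \<in> X" "y \<noteq> z" "delta x y = delta x z"
  shows "beyond_difference x y z i y = of_bool (i = 0)"
  using assms delta_eq_0_iff[of y y] delta_eq_0_iff[of z y]
  by (auto simp: beyond_difference_def beyond_def)

lemma quantum_adjacency_algebra_joint_stabilizer:
  assumes x: "x \<in> X" and "y \<in> X" "z \<in> X" "balanced x y z" and "y' \<in> X" "z' \<in> X" "balanced x y' z'"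
  shows "quantum_adjacency_algebra X E x
    \<subseteq> joint_stabilizer X (beyond_difference x y z) (beyond_difference x y' z')"
  (is "_ \<subseteq> joint_stabilizer X ?e ?f")
  unfolding quantum_adjacency_algebra_def generated_subalgebra_def
proof (rule hull_minimal)
  show "mat_subalgebra X (joint_stabilizer X ?e ?f)"
    using finite_X by (intro mat_subalgebra_joint_stabilizer)
      (auto simp: beyond_difference_def beyond_def)
  have "lowering_matrix X E x \<in> joint_stabilizer X ?e ?f"
  proof (rule joint_stabilizerI)
    show "lowering_matrix X E x \<in> Mat X" by (auto simp: Mat_def lowering_matrix_eq[OF x] E_iff)
  qed (use lower_beyond_difference assms in blast)
  moreover have "raising_matrix X E x \<in> joint_stabilizer X ?e ?f"
  proof (rule joint_stabilizerI)
    show "raising_matrix X E x \<in> Mat X" by (auto simp: Mat_def raising_matrix_eq[OF x] E_iff)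
  qed (use raise_beyond_difference assms in blast)
  moreover have "flat_matrix X E x \<in> joint_stabilizer X ?e ?f"
  proof (rule joint_stabilizerI)
    have "mat_vec X (flat_matrix X E x) g = (\<lambda>u. 0 * h u)" for g h
      by (simp add: mat_vec_def flat_matrix_eq[OF x])
    thus "\<exists>c k. mat_vec X (flat_matrix X E x) (?e i) = (\<lambda>u. c * ?e k u) \<and>
        mat_vec X (flat_matrix X E x) (?f i) = (\<lambda>u. c * ?f k u)" for i by blast
  qed (simp add: Mat_def flat_matrix_eq[OF x])
  ultimately show "{lowering_matrix X E x, flat_matrix X E x, raising_matrix X E x}
      \<subseteq> joint_stabilizer X ?e ?f" by blast
qed

theorem quantum_adjacency_algebra_neq_subconstituent_algebra:
  assumes x: "x \<in> X"
  shows "quantum_adjacency_algebra X E x \<noteq> subconstituent_algebra X E x"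
proof
  assume eq: "quantum_adjacency_algebra X E x = subconstituent_algebra X E x"
  obtain y z where yz: "(x, y) \<in> E" "(x, z) \<in> E" "y \<noteq> z"
    using exists_two_neighbors[OF x] .
  hence yz': "y \<in> X" "z \<in> X" "delta x y = 1" "delta x z = 1" by (auto simp: E_iff)
  obtain y' z' where yz2: "y' \<in> X" "z' \<in> X" "y' \<noteq> z'" "delta x y' = 2" "delta x z' = 2"
    "balanced x y' z'" using exists_balanced_codim_2[OF x] .
  let ?e = "beyond_difference x y z" and ?f = "beyond_difference x y' z'"
  let ?E = "dual_idempotent X E x 1"
  have "1 \<le> eccentricity X E x" using delta_le_eccentricity[OF x yz'(1)] yz' by simp
  hence "?E \<in> subconstituent_algebra X E x"
    unfolding subconstituent_algebra_def generated_subalgebra_def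
    by (intro subsetD[OF hull_subset]) auto
  hence "?E \<in> joint_stabilizer X ?e ?f"
    using quantum_adjacency_algebra_joint_stabilizer[OF x yz'(1,2) _ yz2(1,2,6)]
      balanced_adjacent[OF yz(1,2)] eq by blast
  hence in_span: "(mat_vec X ?E (?e 0), mat_vec X ?E (?f 0)) \<in> pair_span ?e ?f"
    using pair_span_generator[of ?e 0 ?f] by (auto simp: joint_stabilizer_def)
  \<comment> \<open>on the generators both values are 1 for index 0 and vanish for all other indices\<close>
  have "g y = h y'" if "(g, h) \<in> pair_span ?e ?f" for g h
    using that
  proof induction
    case (step g h c i)
    thus ?case using beyond_difference_at yz yz' yz2 by simp
  qed simp
  from this[OF in_span] show False
    using yz' yz2 yz beyond_difference_at
    by (simp add: dual_idempotent_mat_vec[OF finite_X] path_dist_eq[OF x])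
qed

end

theorem proposition11p2:
  fixes q D :: nat
    and scale :: "'k::{field,finite} \<Rightarrow> 'v::ab_group_add \<Rightarrow> 'v"
    and f :: "'v \<Rightarrow> 'k"
    and x :: "'v set"
  assumes "primepow q"
    and "card (UNIV :: 'k set) = q"
    and "D \<ge> 2"
    and "vector_space scale"
    and "vector_space.dim scale (UNIV :: 'v set) = 2 * D"
    and "quadratic_form scale f"
    and "nondegenerate f"
    and "witt_index scale f = D"
    and "x \<in> dual_polar_vertices scale f"
  shows "quantum_adjacency_algebra (dual_polar_vertices scale f) (dual_polar_edges scale f D) x
       \<noteq> subconstituent_algebra (dual_polar_vertices scale f) (dual_polar_edges scale f D) x"
proof -
  interpret vector_space scale by fact
  obtain B where B: "independent B" "UNIV \<subseteq> span B" "card B = dim UNIV"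
    using basis_exists[of UNIV] by blast
  hence "finite B" using assms(3,5) card_gt_0_iff[of B] by linarith
  then interpret hyperbolic_space scale B f D
    using B assms by unfold_locales auto
  show ?thesis
    using quantum_adjacency_algebra_neq_subconstituent_algebra assms(9) unfolding X_def E_def by blast
qed

end
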